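(* Let $X_1$, $X_2$ be locally compact Hausdorff spaces and $E$ be a Hausdorff locally convex space. Let $\mathcal W_1$ and $\mathcal W_2$ be sets of weights on $X_1$ and $X_2$, respectively, such that (i) $\mathcal W_1$ and $\mathcal W_2$ satisfy the $o$-condition, (ii) all weights $f\in\mathcal W_1$, $g\in\mathcal W_2$ are bounded on compact subsets of $X_1$ and $X_2$, respectively, (iii) for each compact subset $K\subseteq X_1$ there exists a weight $f\in\mathcal W_1$ such that $\inf_{x\in K}f(x)>0$, and for each compact subset $L\subseteq X_2$ there exists a weight $g\in\mathcal W_2$ such that $\inf_{y\in L}g(y)>0$. Let $\mathcal W:=\mathcal W_1\otimes\mathcal W_2$. Then the linear map $$\Psi:C_{\mathcal W_1}(X_1,C_{\mathcal W_2}(X_2,E))\to C_{\mathcal W}(X_1\times X_2,E),\quad \gamma\mapsto\gamma^\wedge,$$ where $\gamma^\wedge(x_1,x_2):=\gamma(x_1)(x_2)$, is a homeomorphism.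
   Context: Topological vector spaces are over $\mathbb K\in\{\mathbb R,\mathbb C\}$. For a locally convex space $E$, $\mathcal P_E$ denotes the set of all continuous seminorms on $E$. A set of weights on a Hausdorff topological space $X$ is a nonempty set $\mathcal W$ of functions $f:X\to[0,\infty)$ (called weights) such that for each $x\in X$ there is $f_x\in\mathcal W$ with $f_x(x)>0$. For a Hausdorff locally convex space $E$, a continuous $\gamma:X\to E$, $f\in\mathcal W$ and $q\in\mathcal P_E$ put $\|\gamma\|_{f,q}:=\sup_{x\in X}f(x)q(\gamma(x))\in[0,\infty]$. Then $C_{\mathcal W}(X,E)$ is the vector space of all continuous $\gamma:X\to E$ with $\|\gamma\|_{f,q}<\infty$ for all $f\in\mathcal W$, $q\in\mathcal P_E$, with the (Hausdorff) locally convex topology defined by the seminorms $\|\cdot\|_{f,q}$. For sets of weights $\mathcal W_1$ on $X_1$ and $\mathcal W_2$ on $X_2$, $\mathcal W_1\otimes\mathcal W_2:=\{f_1\otimes f_2: f_1\in\mathcal W_1,f_2\in\mathcal W_2\}$ with $(f_1\otimes f_2)(x_1,x_2):=f_1(x_1)f_2(x_2)$; this is a set of weights on $X_1\times X_2$. For $f,g:X\to[0,\infty)$ write $f=o(g)$ if for each $\varepsilon>0$ there is a compact $K_\varepsilon\subseteq X$ with $f(x)\le\varepsilon g(x)$ for all $x\in X\setminus K_\varepsilon$. A set of weights $\mathcal W$ satisfies the $o$-condition if for each $f\in\mathcal W$ there is $g\in\mathcal W$ with $f=o(g)$. *)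

theory Defs
  imports "HOL-Analysis.Analysis" "HOL-Library.Function_Algebras"
begin

text \<open>
  The scalar field is a type of class real_normed_field. By the Gelfand--Mazur theorem such a field
  is, as a normed field, either the reals or the complex numbers.

  A topological vector space is a topology \<open>T\<close> whose underlying set \<open>topspace T\<close> is a linear subspace
  of an ambient vector space; this is what allows a function space to be used as range space again.
\<close>

locale topological_vector_space_on = vector_space scl
  for scl :: "'k::real_normed_field \<Rightarrow> 'e::ab_group_add \<Rightarrow> 'e" +
  fixes T :: "'e topology"
  assumes subspace_topspace: "subspace (topspace T)"
    and continuous_add: "continuous_map (prod_topology T T) T (\<lambda>(x, y). x + y)"
    and continuous_scale: "continuous_map (prod_topology euclidean T) T (\<lambda>(c, x). scl c x)"

definition convex_wrt :: "('k::real_normed_field \<Rightarrow> 'e::ab_group_add \<Rightarrow> 'e) \<Rightarrow> 'e set \<Rightarrow> bool" where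
  "convex_wrt scl C \<longleftrightarrow>
     (\<forall>x\<in>C. \<forall>y\<in>C. \<forall>t\<in>{0..1}. scl (of_real (1 - t)) x + scl (of_real t) y \<in> C)"

locale locally_convex_space = topological_vector_space_on +
  assumes convex_neighbourhood:
    "\<lbrakk>openin T U; 0 \<in> U\<rbrakk> \<Longrightarrow> \<exists>V C. openin T V \<and> 0 \<in> V \<and> V \<subseteq> C \<and> C \<subseteq> U \<and> convex_wrt scl C"

text \<open>Values outside \<open>topspace T\<close> are unconstrained and never used.\<close>

definition continuous_seminorms ::
  "('k::real_normed_field \<Rightarrow> 'e::ab_group_add \<Rightarrow> 'e) \<Rightarrow> 'e topology \<Rightarrow> ('e \<Rightarrow> real) set" where
  "continuous_seminorms scl T = {q.
     (\<forall>x\<in>topspace T. 0 \<le> q x) \<and>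
     (\<forall>c. \<forall>x\<in>topspace T. q (scl c x) = norm c * q x) \<and>
     (\<forall>x\<in>topspace T. \<forall>y\<in>topspace T. q (x + y) \<le> q x + q y) \<and>
     continuous_map T euclideanreal q}"

definition set_of_weights :: "'x topology \<Rightarrow> ('x \<Rightarrow> real) set \<Rightarrow> bool" where
  "set_of_weights X W \<longleftrightarrow>
     W \<noteq> {} \<and> (\<forall>f\<in>W. \<forall>x\<in>topspace X. 0 \<le> f x) \<and> (\<forall>x\<in>topspace X. \<exists>f\<in>W. 0 < f x)"

definition weighted_norm ::
  "'x topology \<Rightarrow> ('x \<Rightarrow> real) \<Rightarrow> ('e \<Rightarrow> real) \<Rightarrow> ('x \<Rightarrow> 'e) \<Rightarrow> ennreal" where
  "weighted_norm X f q \<gamma> = (SUP x\<in>topspace X. ennreal (f x * q (\<gamma> x)))"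

text \<open>
  A function on \<open>topspace X\<close> is represented by its extension by zero to the whole type, so that
  the vector space operations are the pointwise ones of the function type.
\<close>

definition weighted_space ::
  "'x topology \<Rightarrow> ('x \<Rightarrow> real) set \<Rightarrow> ('k::real_normed_field \<Rightarrow> 'e::ab_group_add \<Rightarrow> 'e) \<Rightarrow>
   'e topology \<Rightarrow> ('x \<Rightarrow> 'e) set" where
  "weighted_space X W scl T = {\<gamma>.
     continuous_map X T \<gamma> \<and> (\<forall>x. x \<notin> topspace X \<longrightarrow> \<gamma> x = 0) \<and>
     (\<forall>f\<in>W. \<forall>q\<in>continuous_seminorms scl T. weighted_norm X f q \<gamma> < \<infinity>)}"

text \<open>
  For nonempty \<open>W\<close> the balls below cover \<open>weighted_space X W scl T\<close>, which is therefore the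
  underlying set of the topology.
\<close>

definition weighted_topology ::
  "'x topology \<Rightarrow> ('x \<Rightarrow> real) set \<Rightarrow> ('k::real_normed_field \<Rightarrow> 'e::ab_group_add \<Rightarrow> 'e) \<Rightarrow>
   'e topology \<Rightarrow> ('x \<Rightarrow> 'e) topology" where
  "weighted_topology X W scl T = topology_generated_by
     {{\<eta> \<in> weighted_space X W scl T. weighted_norm X f q (\<eta> - \<gamma>) < ennreal \<epsilon>} | f q \<gamma> \<epsilon>.
        f \<in> W \<and> q \<in> continuous_seminorms scl T \<and> \<gamma> \<in> weighted_space X W scl T \<and> 0 < \<epsilon>}"

definition pointwise_scale :: "('k \<Rightarrow> 'e \<Rightarrow> 'e) \<Rightarrow> 'k \<Rightarrow> ('x \<Rightarrow> 'e) \<Rightarrow> 'x \<Rightarrow> 'e" where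
  "pointwise_scale scl c \<gamma> = (\<lambda>x. scl c (\<gamma> x))"

definition tensor_weights ::
  "('x \<Rightarrow> real) set \<Rightarrow> ('y \<Rightarrow> real) set \<Rightarrow> ('x \<times> 'y \<Rightarrow> real) set" where
  "tensor_weights W1 W2 = {(\<lambda>(x, y). f x * g y) | f g. f \<in> W1 \<and> g \<in> W2}"

definition little_o_on :: "'x topology \<Rightarrow> ('x \<Rightarrow> real) \<Rightarrow> ('x \<Rightarrow> real) \<Rightarrow> bool" where
  "little_o_on X f g \<longleftrightarrow>
     (\<forall>\<epsilon>>0. \<exists>K. compactin X K \<and> (\<forall>x\<in>topspace X - K. f x \<le> \<epsilon> * g x))"

definition o_condition :: "'x topology \<Rightarrow> ('x \<Rightarrow> real) set \<Rightarrow> bool" where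
  "o_condition X W \<longleftrightarrow> (\<forall>f\<in>W. \<exists>g\<in>W. little_o_on X f g)"

definition linear_between ::
  "('k::field \<Rightarrow> 'a::ab_group_add \<Rightarrow> 'a) \<Rightarrow> 'a set \<Rightarrow> ('k \<Rightarrow> 'b::ab_group_add \<Rightarrow> 'b) \<Rightarrow> 'b set \<Rightarrow>
   ('a \<Rightarrow> 'b) \<Rightarrow> bool" where
  "linear_between sclA A sclB B F \<longleftrightarrow>
     module.subspace sclA A \<and> module.subspace sclB B \<and> F ` A \<subseteq> B \<and>
     (\<forall>x\<in>A. \<forall>y\<in>A. F (x + y) = F x + F y) \<and> (\<forall>c. \<forall>x\<in>A. F (sclA c x) = sclB c (F x))"

definition hat :: "('x \<Rightarrow> 'y \<Rightarrow> 'e) \<Rightarrow> 'x \<times> 'y \<Rightarrow> 'e" where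
  "hat \<gamma> = (\<lambda>(x, y). \<gamma> x y)"

end

theory Submission imports Defs begin

text \<open>
  Write \<open>F\<close> for the weighted space of functions from \<open>X2\<close> to \<open>E\<close>. For \<open>f \<in> W1\<close>, \<open>g \<in> W2\<close> and a
  continuous seminorm \<open>q\<close> on \<open>E\<close>, taking the supremum over \<open>X1 \<times> X2\<close> in two steps shows that the
  joint seminorm of \<open>hat \<gamma>\<close> for \<open>(f \<otimes> g, q)\<close> is the seminorm of \<open>\<gamma>\<close> for \<open>f\<close> and the continuous
  seminorm \<open>(g, q)\<close> of \<open>F\<close>. Every continuous seminorm of \<open>F\<close> is dominated by a multiple of a finite
  sum of seminorms \<open>(g, q)\<close>, so both topologies are defined by equivalent families of seminorms.
  What remains is that the two conditions for membership agree, which comes down to continuity.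

  For a given \<open>\<gamma>\<close>, continuity of \<open>hat \<gamma>\<close> at \<open>(a, b)\<close> (\<open>continuous_map_hat\<close>) uses a compact
  neighbourhood of \<open>b\<close> and a weight \<open>g\<close> bounded away from zero on it: there the seminorm \<open>(g, q)\<close>
  of \<open>\<gamma> x - \<gamma> a\<close> controls \<open>q (\<gamma> x y - \<gamma> a y)\<close> uniformly in \<open>y\<close>.

  Conversely, let \<open>\<eta>\<close> be in the joint space (\<open>continuous_map_section\<close>). To see that
  \<open>x \<mapsto> \<eta> (x, _)\<close> is continuous at \<open>a\<close> for the seminorm \<open>(g, q)\<close>, choose \<open>g' \<in> W2\<close> with
  \<open>g = o(g')\<close>, and \<open>f \<in> W1\<close> bounded away from zero near \<open>a\<close>. Finiteness of the joint seminorm for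
  \<open>(f \<otimes> g', q)\<close> bounds \<open>g' y * q (\<eta> (x, y))\<close> for all \<open>x\<close> near \<open>a\<close> and all \<open>y\<close>, hence
  \<open>g y * q (\<eta> (x, y) - \<eta> (a, y))\<close> is small for \<open>y\<close> outside a compact set \<open>L\<close>. On \<open>L\<close>, where \<open>g\<close> is
  bounded, the tube lemma makes the difference small uniformly in \<open>y\<close>.

  Seminorms enter the definition of the function spaces, whereas a locally convex space is given
  by its convex neighbourhoods. The link is the Minkowski functional of an absolutely convex
  neighbourhood of zero, by which a locally convex topology is generated by its continuous
  seminorms (\<open>seminormed_space_locally_convex\<close>). Weighted spaces are again of this kind
  (\<open>seminormed_space_weighted\<close>), so the same facts apply to \<open>E\<close>, to \<open>F\<close> and to both function
  spaces of the theorem.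
\<close>

section \<open>Seminorms on a subspace\<close>

locale seminorm_on = vector_space scl
  for scl :: "'k::real_normed_field \<Rightarrow> 'e::ab_group_add \<Rightarrow> 'e" +
  fixes S :: "'e set" and q :: "'e \<Rightarrow> real"
  assumes subspace: "subspace S"
    and nonneg: "x \<in> S \<Longrightarrow> 0 \<le> q x"
    and hom: "x \<in> S \<Longrightarrow> q (scl c x) = norm c * q x"
    and triangle: "x \<in> S \<Longrightarrow> y \<in> S \<Longrightarrow> q (x + y) \<le> q x + q y"
begin

lemma zero: "q 0 = 0"
  using hom[of 0 0] subspace_0[OF subspace] by simp

lemma minus: "x \<in> S \<Longrightarrow> q (- x) = q x"
  using hom[of x "-1"] by simp

lemma diff_commute: "x \<in> S \<Longrightarrow> y \<in> S \<Longrightarrow> q (x - y) = q (y - x)"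
  using minus[of "x - y"] subspace_diff[OF subspace] by simp

lemma triangle_diff: "x \<in> S \<Longrightarrow> y \<in> S \<Longrightarrow> z \<in> S \<Longrightarrow> q (x - z) \<le> q (x - y) + q (y - z)"
  using triangle[of "x - y" "y - z"] subspace_diff[OF subspace] by simp

lemma diff_le_add: "x \<in> S \<Longrightarrow> y \<in> S \<Longrightarrow> q (x - y) \<le> q x + q y"
  using triangle[of x "- y"] minus[of y] subspace_neg[OF subspace] by simp

lemma reverse_triangle:
  assumes "x \<in> S" "y \<in> S"
  shows "\<bar>q x - q y\<bar> \<le> q (x - y)"
proof -
  have "q x \<le> q (x - y) + q y"
    using triangle_diff[of x y 0] assms subspace_0[OF subspace] by simp
  moreover have "q y \<le> q (x - y) + q x"
    using triangle_diff[of y x 0] diff_commute[of x y] assms subspace_0[OF subspace] by simp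
  ultimately show ?thesis by linarith
qed

end

lemma continuous_seminorms_iff:
  fixes scl :: "'k::real_normed_field \<Rightarrow> 'e::ab_group_add \<Rightarrow> 'e"
  assumes "vector_space scl" "module.subspace scl (topspace T)"
  shows "q \<in> continuous_seminorms scl T \<longleftrightarrow>
    seminorm_on scl (topspace T) q \<and> continuous_map T euclideanreal q"
proof -
  interpret vector_space scl by fact
  show ?thesis
    using assms(2) vector_space_axioms
    by (auto simp: continuous_seminorms_def seminorm_on_def seminorm_on_axioms_def)
qed

lemma continuous_map_realI:
  assumes "\<And>x e. x \<in> topspace X \<Longrightarrow> 0 < e \<Longrightarrow>
      \<exists>U. openin X U \<and> x \<in> U \<and> (\<forall>y\<in>U. \<bar>h y - h x\<bar> < (e::real))"
  shows "continuous_map X euclideanreal h"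
  unfolding continuous_map_def
proof (intro conjI allI impI)
  fix V :: "real set"
  assume "openin euclideanreal V"
  then have V: "open V" by simp
  show "openin X {x \<in> topspace X. h x \<in> V}"
  proof (subst openin_subopen, intro ballI)
    fix x assume "x \<in> {x \<in> topspace X. h x \<in> V}"
    then have x: "x \<in> topspace X" "h x \<in> V" by auto
    then obtain e where e: "0 < e" "\<And>r. \<bar>r - h x\<bar> < e \<Longrightarrow> r \<in> V"
      using V unfolding open_dist dist_real_def by blast
    obtain U where U: "openin X U" "x \<in> U" "\<forall>y\<in>U. \<bar>h y - h x\<bar> < e"
      using assms[OF x(1) e(1)] by blast
    show "\<exists>U. openin X U \<and> x \<in> U \<and> U \<subseteq> {x \<in> topspace X. h x \<in> V}"
      using U e(2) openin_subset[OF U(1)] by blast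
  qed
qed simp

section \<open>Topologies generated by seminorms\<close>

text \<open>
  The seminorms are indexed, and not merely collected in a set, because the seminorms of a weighted
  space come as pairs of a weight and a seminorm. A finite sum over such pairs on one space is
  turned into a sum over the same pairs on another space, which needs no injectivity.
\<close>

locale seminormed_space = vector_space scl
  for scl :: "'k::real_normed_field \<Rightarrow> 'e::ab_group_add \<Rightarrow> 'e" +
  fixes S :: "'e set" and I :: "'i set" and nrm :: "'i \<Rightarrow> 'e \<Rightarrow> real" and T :: "'e topology"
  assumes subspace_carrier: "subspace S"
    and index_nonempty: "I \<noteq> {}"
    and seminorm_nrm: "i \<in> I \<Longrightarrow> seminorm_on scl S (nrm i)"
    and topology_eq: "T = topology_generated_by
          {{y \<in> S. nrm i (y - x) < e} | i x e. i \<in> I \<and> x \<in> S \<and> 0 < e}"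
begin

lemma topspace_eq: "topspace T = S"
proof -
  obtain i where i: "i \<in> I" using index_nonempty by blast
  interpret seminorm_on scl S "nrm i" by (rule seminorm_nrm[OF i])
  have "y \<in> \<Union>{{y \<in> S. nrm i (y - x) < e} | i x e. i \<in> I \<and> x \<in> S \<and> 0 < e}" if "y \<in> S" for y
  proof (rule UnionI)
    show "{z \<in> S. nrm i (z - y) < 1} \<in> {{y \<in> S. nrm i (y - x) < e} | i x e. i \<in> I \<and> x \<in> S \<and> 0 < e}"
      using i that zero_less_one by blast
    show "y \<in> {z \<in> S. nrm i (z - y) < 1}" using that zero by simp
  qed
  then show ?thesis
    unfolding topology_eq topology_generated_by_topspace by blast
qed

lemma openin_ball: "i \<in> I \<Longrightarrow> x \<in> S \<Longrightarrow> 0 < e \<Longrightarrow> openin T {y \<in> S. nrm i (y - x) < e}"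
  unfolding topology_eq openin_topology_generated_by_iff
  by (rule generate_topology_on.Basis) blast

lemma continuous_map_into_iff:
  "continuous_map X T h \<longleftrightarrow>
    h ` topspace X \<subseteq> S \<and>
    (\<forall>i\<in>I. \<forall>x\<in>topspace X. \<forall>e>0.
       \<exists>U. openin X U \<and> x \<in> U \<and> (\<forall>y\<in>U. nrm i (h y - h x) < e))"
    (is "?L \<longleftrightarrow> ?R")
proof
  assume L: ?L
  show ?R
  proof (intro conjI ballI allI impI)
    show im: "h ` topspace X \<subseteq> S"
      using L topspace_eq by (auto simp: continuous_map_def)
    fix i x and e :: real
    assume i: "i \<in> I" and x: "x \<in> topspace X" and e: "0 < e"
    interpret seminorm_on scl S "nrm i" by (rule seminorm_nrm[OF i])
    have hx: "h x \<in> S" using im x by blast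
    have "openin X {y \<in> topspace X. h y \<in> {z \<in> S. nrm i (z - h x) < e}}"
      by (rule openin_continuous_map_preimage[OF L openin_ball[OF i hx e]])
    then show "\<exists>U. openin X U \<and> x \<in> U \<and> (\<forall>y\<in>U. nrm i (h y - h x) < e)"
      using x hx e zero
      by (intro exI[of _ "{y \<in> topspace X. h y \<in> {z \<in> S. nrm i (z - h x) < e}}"]) simp
  qed
next
  assume R: ?R
  show ?L
    unfolding topology_eq continuous_on_generated_topo_iff
  proof (intro conjI allI impI)
    show "h ` topspace X \<subseteq> \<Union>{{y \<in> S. nrm i (y - x) < e} | i x e. i \<in> I \<and> x \<in> S \<and> 0 < e}"
      using R topspace_eq unfolding topology_eq topology_generated_by_topspace by simp
    fix U assume "U \<in> {{y \<in> S. nrm i (y - x) < e} | i x e. i \<in> I \<and> x \<in> S \<and> 0 < e}"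
    then obtain i a e where i: "i \<in> I" and a: "a \<in> S" and U: "U = {y \<in> S. nrm i (y - a) < e}"
      by blast
    interpret seminorm_on scl S "nrm i" by (rule seminorm_nrm[OF i])
    show "openin X (h -` U \<inter> topspace X)"
    proof (subst openin_subopen, intro ballI)
      fix x assume x: "x \<in> h -` U \<inter> topspace X"
      then have hx: "h x \<in> S" "0 < e - nrm i (h x - a)" unfolding U by auto
      from x i hx(2) R obtain V where V: "openin X V" "x \<in> V"
          "\<And>y. y \<in> V \<Longrightarrow> nrm i (h y - h x) < e - nrm i (h x - a)"
        by (metis IntD2)
      have "y \<in> h -` U \<inter> topspace X" if y: "y \<in> V" for y
      proof -
        have yX: "y \<in> topspace X" using V(1) y openin_subset by blast
        then have hy: "h y \<in> S" using R by blast
        have "nrm i (h y - a) < e"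
          using triangle_diff[OF hy hx(1) a] V(3)[OF y] by linarith
        then show ?thesis using hy yX unfolding U by blast
      qed
      then show "\<exists>V. openin X V \<and> x \<in> V \<and> V \<subseteq> h -` U \<inter> topspace X"
        using V by blast
    qed
  qed
qed

lemma nrm_continuous_seminorm:
  assumes i: "i \<in> I"
  shows "nrm i \<in> continuous_seminorms scl T"
proof -
  interpret seminorm_on scl S "nrm i" by (rule seminorm_nrm[OF i])
  have "continuous_map T euclideanreal (nrm i)"
  proof (rule continuous_map_realI)
    fix x and e :: real
    assume "x \<in> topspace T" "0 < e"
    then have x: "x \<in> S" and e: "0 < e" using topspace_eq by auto
    have "\<bar>nrm i y - nrm i x\<bar> < e" if "y \<in> S" "nrm i (y - x) < e" for y
      using reverse_triangle[OF that(1) x] that(2) by linarith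
    then show "\<exists>U. openin T U \<and> x \<in> U \<and> (\<forall>y\<in>U. \<bar>nrm i y - nrm i x\<bar> < e)"
      using openin_ball[OF i x e] x e zero
      by (intro exI[of _ "{y \<in> S. nrm i (y - x) < e}"]) auto
  qed
  then show ?thesis
    using continuous_seminorms_iff[OF vector_space_axioms, of T "nrm i"] topspace_eq
      subspace_carrier seminorm_on_axioms by simp
qed

lemma seminorm_continuous:
  "q \<in> continuous_seminorms scl T \<Longrightarrow> seminorm_on scl S q"
  using continuous_seminorms_iff[OF vector_space_axioms, of T q] topspace_eq subspace_carrier
  by simp

text \<open>
  The generating balls have arbitrary centres. A ball around \<open>a\<close> that contains \<open>x\<close> contains a ball
  around \<open>x\<close>, whose radius is what the triangle inequality leaves.
\<close>

lemma neighbourhood_contains_ball: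
  assumes "openin T U" "x \<in> U"
  shows "\<exists>J e. finite J \<and> J \<subseteq> I \<and> 0 < e \<and> {y \<in> S. \<forall>j\<in>J. nrm j (y - x) < e} \<subseteq> U"
proof -
  have "generate_topology_on {{y \<in> S. nrm i (y - x) < e} | i x e. i \<in> I \<and> x \<in> S \<and> 0 < e} U"
    using assms(1) unfolding topology_eq openin_topology_generated_by_iff .
  then show ?thesis
    using assms(2)
  proof (induction arbitrary: x rule: generate_topology_on.induct)
    case Empty
    then show ?case by simp
  next
    case (Int a b)
    obtain J e where J: "finite J" "J \<subseteq> I" "0 < e" "{y \<in> S. \<forall>j\<in>J. nrm j (y - x) < e} \<subseteq> a"
      using Int.IH(1)[of x] Int.prems by auto
    obtain K d where K: "finite K" "K \<subseteq> I" "0 < d" "{y \<in> S. \<forall>j\<in>K. nrm j (y - x) < d} \<subseteq> b"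
      using Int.IH(2)[of x] Int.prems by auto
    have "{y \<in> S. \<forall>j\<in>J \<union> K. nrm j (y - x) < min e d}
        \<subseteq> {y \<in> S. \<forall>j\<in>J. nrm j (y - x) < e} \<inter> {y \<in> S. \<forall>j\<in>K. nrm j (y - x) < d}"
      by auto
    then have "{y \<in> S. \<forall>j\<in>J \<union> K. nrm j (y - x) < min e d} \<subseteq> a \<inter> b"
      using J(4) K(4) by (meson Int_mono order_trans)
    moreover have "finite (J \<union> K)" "J \<union> K \<subseteq> I" "0 < min e d"
      using J(1-3) K(1-3) by simp_all
    ultimately show ?case by meson
  next
    case (UN K)
    then obtain k where k: "k \<in> K" "x \<in> k" by blast
    from UN.IH[OF k] obtain J e where
      "finite J" "J \<subseteq> I" "0 < e" "{y \<in> S. \<forall>j\<in>J. nrm j (y - x) < e} \<subseteq> k" by auto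
    moreover have "k \<subseteq> \<Union>K" using k(1) by (rule Union_upper)
    ultimately show ?case by (meson order_trans)
  next
    case (Basis s)
    then obtain i a e where i: "i \<in> I" and a: "a \<in> S" and s: "s = {y \<in> S. nrm i (y - a) < e}"
      by blast
    interpret seminorm_on scl S "nrm i" by (rule seminorm_nrm[OF i])
    have x: "x \<in> S" "0 < e - nrm i (x - a)" using Basis s by auto
    have "y \<in> s" if y: "y \<in> S" "nrm i (y - x) < e - nrm i (x - a)" for y
      using triangle_diff[OF y(1) x(1) a] y unfolding s by simp
    then show ?case
      using i x(2) by (intro exI[of _ "{i}"] exI[of _ "e - nrm i (x - a)"]) auto
  qed
qed

text \<open>
  The seminorm \<open>q\<close> is below \<open>1\<close> on some set where finitely many \<open>nrm j\<close> are below \<open>e\<close>; homogeneity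
  turns this into an inequality with constant \<open>1 / e\<close>. This transfers estimates from the generating
  seminorms to all continuous ones.
\<close>

lemma continuous_seminorm_bound:
  assumes q: "q \<in> continuous_seminorms scl T"
  obtains J C where "finite J" "J \<subseteq> I" "0 \<le> C" "\<And>y. y \<in> S \<Longrightarrow> q y \<le> C * (\<Sum>j\<in>J. nrm j y)"
proof -
  interpret Q: seminorm_on scl S q by (rule seminorm_continuous[OF q])
  have cont: "continuous_map T euclideanreal q"
    using q unfolding continuous_seminorms_def by blast
  have "openin T {y \<in> topspace T. q y \<in> {..<1}}"
    by (rule openin_continuous_map_preimage[OF cont]) simp
  moreover have "0 \<in> {y \<in> topspace T. q y \<in> {..<1}}"
    using Q.zero subspace_0[OF subspace_carrier] topspace_eq by simp
  ultimately have "\<exists>J e. finite J \<and> J \<subseteq> I \<and> 0 < e \<and>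
      {y \<in> S. \<forall>j\<in>J. nrm j (y - 0) < e} \<subseteq> {y \<in> topspace T. q y \<in> {..<1}}"
    by (rule neighbourhood_contains_ball)
  then obtain J e where J: "finite J" "J \<subseteq> I" "0 < e"
    "{y \<in> S. \<forall>j\<in>J. nrm j (y - 0) < e} \<subseteq> {y \<in> topspace T. q y \<in> {..<1}}"
    by (elim exE conjE) (rule that)
  have "q y \<le> (1 / e) * (\<Sum>j\<in>J. nrm j y)" if y: "y \<in> S" for y
  proof -
    let ?s = "\<Sum>j\<in>J. nrm j y"
    have pos: "0 \<le> nrm j y" if "j \<in> J" for j
      by (rule seminorm_on.nonneg[OF seminorm_nrm[OF subsetD[OF J(2) that]] y])
    have le: "nrm j y \<le> ?s" if "j \<in> J" for j
      by (rule member_le_sum[OF that _ J(1)]) (use pos in simp)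
    \<comment> \<open>The sum itself may vanish, so the vector is scaled with a strictly larger \<open>t\<close>.\<close>
    have "e * q y \<le> t" if t: "?s < t" for t
    proof -
      have "0 \<le> ?s" using pos by (rule sum_nonneg)
      then have t0: "0 < t" using t by linarith
      let ?c = "of_real (e / t) :: 'k"
      have nc: "norm ?c = e / t" using J(3) t0 by (simp add: norm_divide)
      have "nrm j (scl ?c y) < e" if j: "j \<in> J" for j
      proof -
        have "nrm j (scl ?c y) = e / t * nrm j y"
          using seminorm_on.hom[OF seminorm_nrm[OF subsetD[OF J(2) j]] y, of ?c] nc by simp
        also have "\<dots> < e / t * t"
          using le[OF j] t J(3) t0 by (intro mult_strict_left_mono) (linarith, simp)
        finally show ?thesis using t0 by simp
      qed
      then have "scl ?c y \<in> {y \<in> S. \<forall>j\<in>J. nrm j (y - 0) < e}"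
        using subspace_scale[OF subspace_carrier y] by simp
      then have "q (scl ?c y) < 1" using J(4) by blast
      then have "e / t * q y < 1" using Q.hom[OF y] nc by simp
      then show ?thesis using t0 by (simp add: field_simps)
    qed
    then have "e * q y \<le> ?s" by (rule dense_ge)
    then show ?thesis using J(3) by (simp add: field_simps)
  qed
  moreover have "0 \<le> 1 / e" using J(3) by simp
  ultimately show ?thesis using that[OF J(1,2)] by blast
qed

lemma continuous_seminorm_scaled_sum:
  assumes "finite J" "0 \<le> C" and p: "\<And>j. j \<in> J \<Longrightarrow> p j \<in> continuous_seminorms scl T"
  shows "(\<lambda>y. C * (\<Sum>j\<in>J. p j y)) \<in> continuous_seminorms scl T"
proof -
  have sn: "seminorm_on scl S (p j)" if "j \<in> J" for j
    using seminorm_continuous[OF p[OF that]] .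
  have "continuous_map T euclideanreal (\<lambda>y. C * (\<Sum>j\<in>J. p j y))"
    using assms by (intro continuous_intros) (auto simp: continuous_seminorms_def)
  moreover have "seminorm_on scl S (\<lambda>y. C * (\<Sum>j\<in>J. p j y))"
  proof
    show "subspace S" by (rule subspace_carrier)
    fix x y and c
    assume x: "x \<in> S"
    show "0 \<le> C * (\<Sum>j\<in>J. p j x)"
      using assms(2) seminorm_on.nonneg[OF sn x] by (simp add: sum_nonneg)
    have "(\<Sum>j\<in>J. p j (scl c x)) = norm c * (\<Sum>j\<in>J. p j x)"
      unfolding sum_distrib_left by (rule sum.cong[OF refl]) (rule seminorm_on.hom[OF sn x])
    then show "C * (\<Sum>j\<in>J. p j (scl c x)) = norm c * (C * (\<Sum>j\<in>J. p j x))" by simp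
    assume y: "y \<in> S"
    have "(\<Sum>j\<in>J. p j (x + y)) \<le> (\<Sum>j\<in>J. p j x) + (\<Sum>j\<in>J. p j y)"
      unfolding sum.distrib[symmetric] by (rule sum_mono) (rule seminorm_on.triangle[OF sn x y])
    then show "C * (\<Sum>j\<in>J. p j (x + y)) \<le> C * (\<Sum>j\<in>J. p j x) + C * (\<Sum>j\<in>J. p j y)"
      using mult_left_mono[OF _ assms(2)] unfolding distrib_left[symmetric] by blast
  qed
  ultimately show ?thesis
    using continuous_seminorms_iff[OF vector_space_axioms, of T] topspace_eq subspace_carrier
    by simp
qed

text \<open>
  In the criterion \<open>continuous_map_into_iff\<close> the generating seminorms may be replaced by an arbitrary
  continuous seminorm.
\<close>

lemma continuous_map_near:
  assumes h: "continuous_map X T h" and q: "q \<in> continuous_seminorms scl T"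
    and x: "x \<in> topspace X" and e: "0 < e"
  shows "\<exists>U. openin X U \<and> x \<in> U \<and> (\<forall>y\<in>U. q (h y - h x) < e)"
proof -
  interpret Q: seminorm_on scl S q by (rule seminorm_continuous[OF q])
  obtain J C where J: "finite J" "J \<subseteq> I" "0 \<le> C" "\<And>y. y \<in> S \<Longrightarrow> q y \<le> C * (\<Sum>j\<in>J. nrm j y)"
    by (rule continuous_seminorm_bound[OF q]) (rule that)
  \<comment> \<open>The added ones avoid division by zero if \<open>C = 0\<close> or \<open>J\<close> is empty.\<close>
  define d where "d = e / ((C + 1) * (real (card J) + 1))"
  have d: "0 < d" using e J(3) unfolding d_def by simp
  have im: "h z \<in> S" if "z \<in> topspace X" for z
    using h that by (auto simp add: continuous_map_into_iff)
  have "\<exists>U. openin X U \<and> x \<in> U \<and> (\<forall>y\<in>U. nrm j (h y - h x) < d)" if "j \<in> J" for j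
    using h x d subsetD[OF J(2) that] by (simp add: continuous_map_into_iff)
  then obtain U where U: "\<And>j. j \<in> J \<Longrightarrow> openin X (U j)" "\<And>j. j \<in> J \<Longrightarrow> x \<in> U j"
      "\<And>j y. j \<in> J \<Longrightarrow> y \<in> U j \<Longrightarrow> nrm j (h y - h x) < d"
    by metis
  let ?V = "topspace X \<inter> \<Inter>(U ` J)"
  have "openin X ?V"
    using openin_Inter[of "insert (topspace X) (U ` J)" X] U(1) J(1) by auto
  moreover have "x \<in> ?V" using x U(2) by blast
  moreover have "q (h y - h x) < e" if y: "y \<in> ?V" for y
  proof -
    have "h y - h x \<in> S" using x y by (intro subspace_diff[OF subspace_carrier] im) auto
    then have "q (h y - h x) \<le> C * (\<Sum>j\<in>J. nrm j (h y - h x))" by (rule J(4))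
    also have "\<dots> \<le> C * (real (card J) * d)"
      using U(3) y by (intro mult_left_mono[OF _ J(3)] sum_bounded_above less_imp_le) simp
    also have "\<dots> < ((C + 1) * (real (card J) + 1)) * d"
      using J(3) d by (simp add: algebra_simps add_pos_nonneg)
    also have "\<dots> = e" using J(3) unfolding d_def by simp
    finally show ?thesis .
  qed
  ultimately show ?thesis by blast
qed

lemma continuous_map_add:
  assumes g: "continuous_map X T g" and h: "continuous_map X T h"
  shows "continuous_map X T (\<lambda>x. g x + h x)"
  unfolding continuous_map_into_iff
proof (intro conjI ballI allI impI)
  have im: "g z \<in> S" "h z \<in> S" if "z \<in> topspace X" for z
    using g h that by (auto simp: continuous_map_into_iff)
  show "(\<lambda>x. g x + h x) ` topspace X \<subseteq> S"
    by (intro image_subsetI subspace_add[OF subspace_carrier] im)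
  fix i x and e :: real
  assume i: "i \<in> I" and x: "x \<in> topspace X" and e: "0 < e"
  interpret seminorm_on scl S "nrm i" by (rule seminorm_nrm[OF i])
  obtain U where U: "openin X U" "x \<in> U" "\<forall>y\<in>U. nrm i (g y - g x) < e / 2"
    using continuous_map_near[OF g nrm_continuous_seminorm[OF i] x, of "e / 2"] e by auto
  obtain V where V: "openin X V" "x \<in> V" "\<forall>y\<in>V. nrm i (h y - h x) < e / 2"
    using continuous_map_near[OF h nrm_continuous_seminorm[OF i] x, of "e / 2"] e by auto
  have "nrm i (g y + h y - (g x + h x)) < e" if y: "y \<in> U \<inter> V" for y
  proof -
    have yX: "y \<in> topspace X" using y U(1) openin_subset by blast
    have "g y - g x \<in> S" "h y - h x \<in> S"
      by (intro subspace_diff[OF subspace_carrier] im x yX)+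
    then have "nrm i ((g y - g x) + (h y - h x)) \<le> nrm i (g y - g x) + nrm i (h y - h x)"
      by (rule triangle)
    also have "\<dots> < e / 2 + e / 2" using U(3) V(3) y by (intro add_strict_mono) auto
    finally show ?thesis by (simp add: add_diff_add)
  qed
  then show "\<exists>U. openin X U \<and> x \<in> U \<and> (\<forall>y\<in>U. nrm i (g y + h y - (g x + h x)) < e)"
    using U(1,2) V(1,2) by (intro exI[of _ "U \<inter> V"]) auto
qed

lemma continuous_map_scale:
  assumes h: "continuous_map X T h"
  shows "continuous_map X T (\<lambda>x. scl c (h x))"
  unfolding continuous_map_into_iff
proof (intro conjI ballI allI impI)
  have im: "h z \<in> S" if "z \<in> topspace X" for z
    using h that by (auto simp: continuous_map_into_iff)
  show "(\<lambda>x. scl c (h x)) ` topspace X \<subseteq> S"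
    by (intro image_subsetI subspace_scale[OF subspace_carrier] im)
  fix i x and e :: real
  assume i: "i \<in> I" and x: "x \<in> topspace X" and e: "0 < e"
  interpret seminorm_on scl S "nrm i" by (rule seminorm_nrm[OF i])
  define d where "d = e / (norm c + 1)"
  have c1: "0 < norm c + 1" using norm_ge_zero[of c] by linarith
  then have d: "0 < d" using e unfolding d_def by simp
  obtain U where U: "openin X U" "x \<in> U" "\<forall>y\<in>U. nrm i (h y - h x) < d"
    using continuous_map_near[OF h nrm_continuous_seminorm[OF i] x d] by blast
  have "nrm i (scl c (h y) - scl c (h x)) < e" if y: "y \<in> U" for y
  proof -
    have "h y - h x \<in> S"
      using x y openin_subset[OF U(1)] by (intro subspace_diff[OF subspace_carrier] im) auto
    then have "nrm i (scl c (h y) - scl c (h x)) = norm c * nrm i (h y - h x)"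
      using hom[of "h y - h x" c] by (simp add: scale_right_diff_distrib)
    also have "\<dots> \<le> norm c * d" using U(3) y by (intro mult_left_mono) auto
    also have "\<dots> < (norm c + 1) * d" using d by (simp add: algebra_simps)
    also have "\<dots> = e" using c1 unfolding d_def by simp
    finally show ?thesis .
  qed
  then show "\<exists>U. openin X U \<and> x \<in> U \<and> (\<forall>y\<in>U. nrm i (scl c (h y) - scl c (h x)) < e)"
    using U by blast
qed

lemma continuous_map_diff:
  assumes "continuous_map X T g" "continuous_map X T h"
  shows "continuous_map X T (\<lambda>x. g x - h x)"
  using continuous_map_add[OF assms(1) continuous_map_scale[OF assms(2), of "-1"]] by simp

lemma continuous_map_zero: "continuous_map X T (\<lambda>x. 0)"
  using subspace_0[OF subspace_carrier] topspace_eq by simp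

end

section \<open>Locally convex spaces are topologised by their continuous seminorms\<close>

text \<open>
  The Minkowski functional of \<open>D\<close>. Dilations are by real factors, embedded in the scalar field.
\<close>

definition minkowski :: "('k::real_normed_field \<Rightarrow> 'e::ab_group_add \<Rightarrow> 'e) \<Rightarrow> 'e set \<Rightarrow> 'e \<Rightarrow> real" where
  "minkowski scl D x = Inf {t. 0 < t \<and> scl (of_real (inverse t)) x \<in> D}"

locale absolutely_convex_absorbing = vector_space scl
  for scl :: "'k::real_normed_field \<Rightarrow> 'e::ab_group_add \<Rightarrow> 'e" +
  fixes S D :: "'e set"
  assumes subspace_S: "subspace S"
    and convex: "convex_wrt scl D"
    and balanced: "norm c \<le> 1 \<Longrightarrow> x \<in> D \<Longrightarrow> scl c x \<in> D"
    and absorbing: "x \<in> S \<Longrightarrow> \<exists>t>0. scl (of_real (inverse t)) x \<in> D"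
begin

lemma minkowski_le: "0 < t \<Longrightarrow> scl (of_real (inverse t)) x \<in> D \<Longrightarrow> minkowski scl D x \<le> t"
  unfolding minkowski_def by (rule cInf_lower) (auto intro: bdd_belowI[of _ 0])

text \<open>
  A dilation factor below \<open>t\<close> exists since the infimum is below \<open>t\<close>, and balancedness allows it to be
  enlarged to \<open>t\<close>.
\<close>

lemma minkowski_less:
  assumes "x \<in> S" "minkowski scl D x < t"
  shows "0 < t" "scl (of_real (inverse t)) x \<in> D"
proof -
  have "{t. 0 < t \<and> scl (of_real (inverse t)) x \<in> D} \<noteq> {}"
    using absorbing[OF assms(1)] by blast
  from cInf_lessD[OF this assms(2)[unfolded minkowski_def]]
  obtain s where s: "0 < s" "scl (of_real (inverse s)) x \<in> D" "s < t" by blast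
  show t: "0 < t" using s by linarith
  have "norm (of_real (s / t) :: 'k) \<le> 1" using s t by (simp add: norm_divide)
  from balanced[OF this s(2)]
  have "scl (of_real (s / t) * of_real (inverse s)) x \<in> D" by simp
  moreover have "(of_real (s / t) * of_real (inverse s) :: 'k) = of_real (inverse t)"
    unfolding of_real_mult[symmetric] using s(1) by (simp add: field_simps)
  ultimately show "scl (of_real (inverse t)) x \<in> D" by simp
qed

lemma minkowski_nonneg:
  assumes "x \<in> S"
  shows "0 \<le> minkowski scl D x"
  by (rule dense_ge) (rule less_imp_le[OF minkowski_less(1)[OF assms]])

text \<open>
  If \<open>x / s\<close> and \<open>y / t\<close> lie in \<open>D\<close>, then \<open>(x + y) / (s + t)\<close> is their convex combination with
  coefficients \<open>s / (s + t)\<close> and \<open>t / (s + t)\<close>.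
\<close>

lemma minkowski_add_le:
  assumes x: "x \<in> S" and y: "y \<in> S"
  shows "minkowski scl D (x + y) \<le> minkowski scl D x + minkowski scl D y"
proof (rule field_le_epsilon)
  fix e :: real
  assume e: "0 < e"
  define s t where "s = minkowski scl D x + e / 2" and "t = minkowski scl D y + e / 2"
  have s: "0 < s" "scl (of_real (inverse s)) x \<in> D"
    using minkowski_less[OF x, of s] e unfolding s_def by auto
  have t: "0 < t" "scl (of_real (inverse t)) y \<in> D"
    using minkowski_less[OF y, of t] e unfolding t_def by auto
  define r where "r = t / (s + t)"
  have r: "r \<in> {0..1}" "1 - r = s / (s + t)" using s(1) t(1) unfolding r_def by (auto simp: field_simps)
  have "scl (of_real (1 - r)) (scl (of_real (inverse s)) x) + scl (of_real r) (scl (of_real (inverse t)) y) \<in> D"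
    using convex s(2) t(2) r(1) unfolding convex_wrt_def by blast
  then have "scl (of_real ((1 - r) * inverse s)) x + scl (of_real (r * inverse t)) y \<in> D"
    unfolding of_real_mult scale_scale .
  moreover have "(1 - r) * inverse s = inverse (s + t)"
    unfolding r(2) using s(1) t(1) by (simp add: field_simps)
  moreover have "r * inverse t = inverse (s + t)"
    unfolding r_def using s(1) t(1) by (simp add: field_simps)
  ultimately have "scl (of_real (inverse (s + t))) (x + y) \<in> D"
    by (simp add: scale_right_distrib)
  then have "minkowski scl D (x + y) \<le> s + t"
    using s(1) t(1) by (intro minkowski_le) auto
  then show "minkowski scl D (x + y) \<le> minkowski scl D x + minkowski scl D y + e"
    unfolding s_def t_def by simp
qed

text \<open>
  The scalar \<open>c / norm c\<close> has norm \<open>1\<close>, so it maps \<open>D\<close> into itself. Equality follows afterwards by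
  applying the inequality to \<open>inverse c\<close> as well.
\<close>

lemma minkowski_scale_le:
  assumes x: "x \<in> S" and c: "c \<noteq> 0"
  shows "minkowski scl D (scl c x) \<le> norm c * minkowski scl D x"
proof -
  have "minkowski scl D (scl c x) / norm c \<le> t" if t: "minkowski scl D x < t" for t
  proof -
    note t' = minkowski_less[OF x t]
    let ?u = "c * of_real (inverse (norm c)) :: 'k"
    have "norm ?u \<le> 1" using c by (simp add: norm_mult norm_inverse)
    from balanced[OF this t'(2)]
    have "scl (?u * of_real (inverse t)) x \<in> D" by simp
    moreover have "?u * of_real (inverse t) = of_real (inverse (norm c * t)) * c" by simp
    ultimately have "scl (of_real (inverse (norm c * t))) (scl c x) \<in> D"
      by (simp only: scale_scale)
    then have "minkowski scl D (scl c x) \<le> norm c * t"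
      using t'(1) c by (intro minkowski_le) auto
    then show ?thesis using c by (simp add: field_simps)
  qed
  then have "minkowski scl D (scl c x) / norm c \<le> minkowski scl D x" by (rule dense_ge)
  then show ?thesis using c by (simp add: field_simps)
qed

lemma minkowski_scale:
  assumes x: "x \<in> S"
  shows "minkowski scl D (scl c x) = norm c * minkowski scl D x"
proof (cases "c = 0")
  case True
  have z: "0 \<in> S" by (rule subspace_0[OF subspace_S])
  obtain t where "scl (of_real (inverse t)) 0 \<in> D" using absorbing[OF z] by blast
  then have "0 \<in> D" by simp
  then have "minkowski scl D 0 \<le> t" if "0 < t" for t using that by (intro minkowski_le) simp_all
  then have "minkowski scl D 0 \<le> 0" by (rule dense_ge)
  then show ?thesis using True minkowski_nonneg[OF z] by simp
next
  case False
  have "minkowski scl D (scl (inverse c) (scl c x)) \<le> norm (inverse c) * minkowski scl D (scl c x)"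
    using False by (intro minkowski_scale_le subspace_scale[OF subspace_S x]) simp
  then have "norm c * minkowski scl D x \<le> minkowski scl D (scl c x)"
    using False by (simp add: norm_divide field_simps)
  then show ?thesis using minkowski_scale_le[OF x False] by linarith
qed

lemma seminorm_on_minkowski: "seminorm_on scl S (minkowski scl D)"
  by unfold_locales (simp_all add: subspace_S minkowski_nonneg minkowski_scale minkowski_add_le)

end

context topological_vector_space_on
begin

lemma continuous_map_scale_right: "continuous_map T T (scl c)"
proof -
  have "continuous_map T T ((\<lambda>(c, x). scl c x) \<circ> (\<lambda>x. (c, x)))"
    by (rule continuous_map_compose[OF _ continuous_scale])
       (intro continuous_map_pairedI continuous_map_const[THEN iffD2] continuous_map_id[unfolded id_def]; simp)
  then show ?thesis by (simp add: o_def)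
qed

lemma continuous_map_scale_left:
  assumes "x \<in> topspace T"
  shows "continuous_map euclidean T (\<lambda>c. scl c x)"
proof -
  have "continuous_map euclidean T ((\<lambda>(c, x). scl c x) \<circ> (\<lambda>c. (c, x)))"
    by (rule continuous_map_compose[OF _ continuous_scale])
       (intro continuous_map_pairedI continuous_map_const[THEN iffD2] continuous_map_id[unfolded id_def]; simp add: assms)
  then show ?thesis by (simp add: o_def)
qed

lemma continuous_map_translate:
  assumes "a \<in> topspace T"
  shows "continuous_map T T (\<lambda>x. x + a)"
proof -
  have "continuous_map T T ((\<lambda>(x, y). x + y) \<circ> (\<lambda>x. (x, a)))"
    by (rule continuous_map_compose[OF _ continuous_add])
       (intro continuous_map_pairedI continuous_map_const[THEN iffD2] continuous_map_id[unfolded id_def]; simp add: assms)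
  then show ?thesis by (simp add: o_def)
qed

lemma openin_translate:
  assumes "openin T U" "a \<in> topspace T"
  shows "openin T {x \<in> topspace T. x - a \<in> U}"
  using openin_continuous_map_preimage[OF continuous_map_translate[of "- a"] assms(1)]
    subspace_neg[OF subspace_topspace assms(2)] by simp

end

context locally_convex_space
begin

text \<open>
  The balanced core of a convex set \<open>C\<close>, formed by the vectors all of whose multiples by scalars of
  norm at most \<open>1\<close> lie in \<open>C\<close>, is again convex. It is a neighbourhood of zero because scalar
  multiplication is jointly continuous at \<open>(0, 0)\<close>.
\<close>

lemma absolutely_convex_neighbourhood:
  assumes U: "openin T U" "0 \<in> U"
  obtains N D where "openin T N" "0 \<in> N" "N \<subseteq> D" "D \<subseteq> U" "convex_wrt scl D"
    "\<And>c x. norm c \<le> 1 \<Longrightarrow> x \<in> D \<Longrightarrow> scl c x \<in> D"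
proof -
  obtain V C where V: "openin T V" "0 \<in> V" "V \<subseteq> C" and C: "C \<subseteq> U" "convex_wrt scl C"
    using convex_neighbourhood[OF U] by (elim exE conjE) (rule that)
  define D where "D = {x. \<forall>c. norm c \<le> 1 \<longrightarrow> scl c x \<in> C}"
  have zero: "0 \<in> topspace T" by (rule subspace_0[OF subspace_topspace])
  have "openin (prod_topology euclidean T)
      {z \<in> topspace (prod_topology euclidean T). (\<lambda>(c, x). scl c x) z \<in> V}"
    by (rule openin_continuous_map_preimage[OF continuous_scale V(1)])
  moreover have "(0, 0) \<in> {z \<in> topspace (prod_topology euclidean T). (\<lambda>(c, x). scl c x) z \<in> V}"
    using V(2) zero by simp
  ultimately have "\<exists>A B. openin euclidean A \<and> openin T B \<and> 0 \<in> A \<and> 0 \<in> B \<and>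
      A \<times> B \<subseteq> {z \<in> topspace (prod_topology euclidean T). (\<lambda>(c, x). scl c x) z \<in> V}"
    by (rule openin_prod_topology_alt[THEN iffD1, rule_format])
  then obtain A B where A: "openin euclidean A" "0 \<in> A" and B: "openin T B" "0 \<in> B"
    and AB: "A \<times> B \<subseteq> {z \<in> topspace (prod_topology euclidean T). (\<lambda>(c, x). scl c x) z \<in> V}"
    by (elim exE conjE) (rule that)
  have "open A" using A(1) by (simp only: open_openin topspace_euclidean UNIV_I simp_thms)
  then obtain d where "0 < d" and "ball 0 d \<subseteq> A"
    using A(2) by (rule openE)
  then have d: "0 < d" "\<And>c. norm c < d \<Longrightarrow> c \<in> A" by (auto simp: subset_iff)
  \<comment> \<open>This is \<open>(d / 2) B\<close>: for \<open>norm c \<le> 1\<close> the scalar \<open>c * d / 2\<close> still lies in the ball of radius \<open>d\<close>.\<close>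
  define N where "N = {x \<in> topspace T. scl (of_real (2 / d)) x \<in> B}"
  have ND: "N \<subseteq> D"
  proof
    fix x assume x: "x \<in> N"
    have "scl c x \<in> C" if c: "norm c \<le> 1" for c
    proof -
      have "norm (c * of_real (d / 2)) \<le> 1 * (d / 2)"
        unfolding norm_mult norm_of_real using c d(1) by (intro mult_mono) auto
      then have "norm (c * of_real (d / 2)) < d" using d(1) by linarith
      then have "(c * of_real (d / 2), scl (of_real (2 / d)) x) \<in> A \<times> B"
        using d(2) x unfolding N_def by simp
      from subsetD[OF AB this]
      have "scl (c * of_real (d / 2)) (scl (of_real (2 / d)) x) \<in> V"
        unfolding mem_Collect_eq prod.case by (rule conjunct2)
      moreover have "c * of_real (d / 2) * of_real (2 / d) = c"
        unfolding mult.assoc of_real_mult[symmetric] using d(1) by simp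
      ultimately have "scl c x \<in> V" by (simp only: scale_scale)
      then show ?thesis by (rule subsetD[OF V(3)])
    qed
    then show "x \<in> D" unfolding D_def by blast
  qed
  have N: "openin T N"
    unfolding N_def by (rule openin_continuous_map_preimage[OF continuous_map_scale_right B(1)])
  have N0: "0 \<in> N" using zero B(2) unfolding N_def by simp
  have DU: "D \<subseteq> U"
  proof
    fix x assume "x \<in> D"
    then have "scl 1 x \<in> C" unfolding D_def mem_Collect_eq by (elim allE impE) (rule norm_one[THEN eq_refl])
    then have "x \<in> C" unfolding scale_one .
    then show "x \<in> U" by (rule subsetD[OF C(1)])
  qed
  have conv: "convex_wrt scl D"
    unfolding convex_wrt_def
  proof (intro ballI)
    fix x y and t :: real
    assume x: "x \<in> D" and y: "y \<in> D" and t: "t \<in> {0..1}"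
    have "scl c (scl (of_real (1 - t)) x + scl (of_real t) y) \<in> C" if c: "norm c \<le> 1" for c
    proof -
      have "scl c x \<in> C" "scl c y \<in> C" using x y c unfolding D_def mem_Collect_eq by auto
      then have "scl (of_real (1 - t)) (scl c x) + scl (of_real t) (scl c y) \<in> C"
        using C(2) t unfolding convex_wrt_def by blast
      then show ?thesis by (simp only: scale_right_distrib scale_scale mult.commute)
    qed
    then show "scl (of_real (1 - t)) x + scl (of_real t) y \<in> D" unfolding D_def by blast
  qed
  have bal: "scl c x \<in> D" if "norm c \<le> 1" "x \<in> D" for c x
  proof -
    have "norm (b * c) \<le> 1" if "norm b \<le> 1" for b
      using mult_le_one[of "norm b" "norm c"] that \<open>norm c \<le> 1\<close> by (simp add: norm_mult)
    then show ?thesis using \<open>x \<in> D\<close> unfolding D_def by simp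
  qed
  show ?thesis by (rule that[OF N N0 ND DU conv bal])
qed

text \<open>
  The seminorm is the Minkowski functional of an absolutely convex neighbourhood \<open>D \<subseteq> U\<close>. It is
  continuous because it is at most \<open>e / 2\<close> on \<open>(e / 2) D\<close>, which is a neighbourhood of zero.
\<close>

lemma continuous_seminorm_within_neighbourhood:
  assumes U: "openin T U" "0 \<in> U"
  obtains q where "q \<in> continuous_seminorms scl T" "\<And>x. x \<in> topspace T \<Longrightarrow> q x < 1 \<Longrightarrow> x \<in> U"
proof -
  obtain N D where N: "openin T N" "0 \<in> N" "N \<subseteq> D" and D: "D \<subseteq> U" "convex_wrt scl D"
      "\<And>c x. norm c \<le> 1 \<Longrightarrow> x \<in> D \<Longrightarrow> scl c x \<in> D"
    by (rule absolutely_convex_neighbourhood[OF U]) (rule that)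
  have absorbing: "\<exists>t>0. scl (of_real (inverse t)) x \<in> D" if x: "x \<in> topspace T" for x
  proof -
    have "openin euclidean {c \<in> topspace euclidean. scl c x \<in> N}"
      by (rule openin_continuous_map_preimage[OF continuous_map_scale_left[OF x] N(1)])
    then have "open {c. scl c x \<in> N}" by (simp only: open_openin topspace_euclidean UNIV_I simp_thms)
    moreover have "0 \<in> {c. scl c x \<in> N}" using N(2) by simp
    ultimately obtain e where "0 < e" and "ball 0 e \<subseteq> {c. scl c x \<in> N}"
      by (rule openE)
    then have e: "0 < e" "\<And>c. norm c < e \<Longrightarrow> scl c x \<in> N" by (auto simp: subset_iff)
    have "scl (of_real (inverse (2 / e))) x \<in> D"
      using e N(3) by (intro subsetD[OF N(3)] e(2)) (simp add: norm_divide)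
    then show ?thesis using e(1) by (intro exI[of _ "2 / e"]) simp
  qed
  interpret absolutely_convex_absorbing scl "topspace T" D
    by unfold_locales (use subspace_topspace D absorbing in auto)
  interpret G: seminorm_on scl "topspace T" "minkowski scl D" by (rule seminorm_on_minkowski)
  have "continuous_map T euclideanreal (minkowski scl D)"
  proof (rule continuous_map_realI)
    fix x and e :: real
    assume x: "x \<in> topspace T" and e: "0 < e"
    define M where "M = {z \<in> topspace T. scl (of_real (2 / e)) z \<in> N}"
    let ?U = "{y \<in> topspace T. y - x \<in> M}"
    have "openin T M"
      unfolding M_def by (rule openin_continuous_map_preimage[OF continuous_map_scale_right N(1)])
    then have "openin T ?U" using x by (rule openin_translate)
    moreover have "x \<in> ?U"
      using x N(2) subspace_0[OF subspace_topspace] unfolding M_def by simp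
    moreover have "\<bar>minkowski scl D y - minkowski scl D x\<bar> < e" if y: "y \<in> ?U" for y
    proof -
      have "scl (of_real (inverse (e / 2))) (y - x) \<in> D"
        using y N(3) unfolding M_def by auto
      then have "minkowski scl D (y - x) \<le> e / 2" using e by (intro minkowski_le) auto
      then show ?thesis using G.reverse_triangle[of y x] y x e by auto
    qed
    ultimately show "\<exists>U. openin T U \<and> x \<in> U \<and> (\<forall>y\<in>U. \<bar>minkowski scl D y - minkowski scl D x\<bar> < e)"
      by blast
  qed
  then have "minkowski scl D \<in> continuous_seminorms scl T"
    using continuous_seminorms_iff[OF vector_space_axioms subspace_topspace] seminorm_on_minkowski
    by blast
  moreover have "x \<in> U" if "x \<in> topspace T" "minkowski scl D x < 1" for x
    using minkowski_less(2)[OF that] D(1) by auto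
  ultimately show ?thesis by (rule that)
qed

text \<open>
  For an open set \<open>U\<close> and \<open>x \<in> U\<close>, translating by \<open>- x\<close> gives a neighbourhood of zero, and the unit ball
  of a seminorm inside it, translated back, is a ball around \<open>x\<close> inside \<open>U\<close>.
\<close>

lemma seminormed_space_locally_convex:
  "seminormed_space scl (topspace T) (continuous_seminorms scl T) (\<lambda>q. q) T"
proof (intro seminormed_space.intro seminormed_space_axioms.intro)
  show "vector_space scl" by (rule vector_space_axioms)
  show "subspace (topspace T)" by (rule subspace_topspace)
  have "openin T (topspace T)" "0 \<in> topspace T"
    using subspace_0[OF subspace_topspace] by auto
  then obtain q where "q \<in> continuous_seminorms scl T"
    by (rule continuous_seminorm_within_neighbourhood)
  then show "continuous_seminorms scl T \<noteq> {}"
    by blast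
  show "seminorm_on scl (topspace T) q" if "q \<in> continuous_seminorms scl T" for q
    using that continuous_seminorms_iff[OF vector_space_axioms subspace_topspace] by blast
  let ?B = "{{y \<in> topspace T. q (y - x) < e} | q x e.
      q \<in> continuous_seminorms scl T \<and> x \<in> topspace T \<and> 0 < e}"
  have ball: "openin T b" if b: "b \<in> ?B" for b
  proof -
    obtain q x e where q: "q \<in> continuous_seminorms scl T" and x: "x \<in> topspace T"
      and b: "b = {y \<in> topspace T. q (y - x) < e}" using b by blast
    have "continuous_map T euclideanreal q" using q unfolding continuous_seminorms_def by blast
    then have "openin T {z \<in> topspace T. q z \<in> {..<e}}"
      by (rule openin_continuous_map_preimage) simp
    from openin_translate[OF this x] show ?thesis
      using subspace_diff[OF subspace_topspace _ x] unfolding b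
      by (simp add: conj_ac cong: conj_cong)
  qed
  show "T = topology_generated_by ?B"
    unfolding topology_eq openin_topology_generated_by_iff
  proof (intro allI iffI)
    fix U assume "generate_topology_on ?B U"
    then show "openin T U"
      by (induction rule: generate_topology_on.induct) (auto simp only: openin_empty intro: ball)
  next
    fix U assume U: "openin T U"
    have sub: "\<exists>b. openin (topology_generated_by ?B) b \<and> x \<in> b \<and> b \<subseteq> U" if x: "x \<in> U" for x
    proof -
      have xT: "x \<in> topspace T" using U x openin_subset by blast
      let ?V = "{y \<in> topspace T. y - (- x) \<in> U}"
      have "openin T ?V"
        by (rule openin_translate[OF U subspace_neg[OF subspace_topspace xT]])
      moreover have "0 \<in> ?V" using x subspace_0[OF subspace_topspace] by simp
      ultimately obtain q where q: "q \<in> continuous_seminorms scl T"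
        "\<And>z. z \<in> topspace T \<Longrightarrow> q z < 1 \<Longrightarrow> z \<in> ?V"
        by (rule continuous_seminorm_within_neighbourhood) (rule that)
      interpret seminorm_on scl "topspace T" q
        using q(1) continuous_seminorms_iff[OF vector_space_axioms subspace_topspace] by blast
      let ?b = "{y \<in> topspace T. q (y - x) < 1}"
      have "?b \<in> ?B" using q(1) xT zero_less_one by blast
      then have "openin (topology_generated_by ?B) ?b"
        unfolding openin_topology_generated_by_iff by (rule generate_topology_on.Basis)
      moreover have "x \<in> ?b" using xT zero by simp
      moreover have "?b \<subseteq> U"
      proof
        fix y assume y: "y \<in> ?b"
        then have "y - x \<in> ?V" by (intro q(2) subspace_diff[OF subspace_topspace _ xT]) auto
        then show "y \<in> U" by simp
      qed
      ultimately show ?thesis by blast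
    qed
    show "generate_topology_on ?B U"
      by (rule openin_topology_generated_by_iff[THEN iffD1, OF openin_subopen[THEN iffD2]])
        (intro ballI sub)
  qed
qed

end

section \<open>Weighted function spaces\<close>

text \<open>
  Members of a weighted space have finite weighted norms, so the conversion to a real number is
  faithful on them; a function of infinite weighted norm gets the meaningless value \<open>0\<close>.
\<close>

definition weighted_seminorm ::
  "'x topology \<Rightarrow> ('x \<Rightarrow> real) \<Rightarrow> ('e \<Rightarrow> real) \<Rightarrow> ('x \<Rightarrow> 'e) \<Rightarrow> real" where
  "weighted_seminorm X f q \<gamma> = enn2real (weighted_norm X f q \<gamma>)"

lemma weighted_seminorm_nonneg: "0 \<le> weighted_seminorm X f q \<gamma>"
  unfolding weighted_seminorm_def by simp

lemma weighted_norm_le_iff: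
  assumes "0 \<le> c"
  shows "weighted_norm X f q \<gamma> \<le> ennreal c \<longleftrightarrow> (\<forall>x\<in>topspace X. f x * q (\<gamma> x) \<le> c)"
  unfolding weighted_norm_def SUP_le_iff using assms by simp

lemma weighted_norm_finite:
  assumes "\<And>x. x \<in> topspace X \<Longrightarrow> f x * q (\<gamma> x) \<le> c"
  shows "weighted_norm X f q \<gamma> < \<infinity>"
proof -
  have "weighted_norm X f q \<gamma> \<le> ennreal (max 0 c)"
    using assms by (subst weighted_norm_le_iff) (auto intro: max.coboundedI2)
  also have "\<dots> < \<infinity>" by simp
  finally show ?thesis .
qed

lemma weighted_seminorm_le:
  assumes "0 \<le> c" "\<And>x. x \<in> topspace X \<Longrightarrow> f x * q (\<gamma> x) \<le> c"
  shows "weighted_seminorm X f q \<gamma> \<le> c"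
  unfolding weighted_seminorm_def
  using assms by (intro enn2real_leI) (auto simp: weighted_norm_le_iff)

lemma le_weighted_seminorm:
  assumes "weighted_norm X f q \<gamma> < \<infinity>" "x \<in> topspace X"
  shows "f x * q (\<gamma> x) \<le> weighted_seminorm X f q \<gamma>"
proof -
  have "weighted_norm X f q \<gamma> = ennreal (weighted_seminorm X f q \<gamma>)"
    using assms(1) unfolding weighted_seminorm_def by simp
  then have "weighted_norm X f q \<gamma> \<le> ennreal (weighted_seminorm X f q \<gamma>)" by simp
  then show ?thesis
    unfolding weighted_norm_le_iff[OF weighted_seminorm_nonneg] using assms(2) by blast
qed

lemma weighted_norm_less_iff:
  assumes "weighted_norm X f q \<gamma> < \<infinity>"
  shows "weighted_norm X f q \<gamma> < ennreal e \<longleftrightarrow> weighted_seminorm X f q \<gamma> < e"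
proof -
  have "weighted_norm X f q \<gamma> = ennreal (weighted_seminorm X f q \<gamma>)"
    using assms(1) unfolding weighted_seminorm_def by simp
  then show ?thesis using weighted_seminorm_nonneg[of X f q \<gamma>] by (simp add: ennreal_less_iff)
qed

lemma vector_space_pointwise_scale:
  assumes "vector_space scl"
  shows "vector_space (pointwise_scale scl)"
proof -
  interpret vector_space scl by fact
  show ?thesis
    by unfold_locales
      (simp_all add: pointwise_scale_def fun_eq_iff scale_right_distrib scale_left_distrib)
qed

locale weighted_functions = seminormed_space scl S I nrm T
  for scl :: "'k::real_normed_field \<Rightarrow> 'e::ab_group_add \<Rightarrow> 'e" and S and I :: "'i set" and nrm T +
  fixes X :: "'x topology" and W :: "('x \<Rightarrow> real) set"
  assumes weights_nonempty: "W \<noteq> {}"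
    and weight_nonneg: "f \<in> W \<Longrightarrow> x \<in> topspace X \<Longrightarrow> 0 \<le> f x"
begin

lemma weighted_spaceI:
  assumes "continuous_map X T \<gamma>" "\<And>x. x \<notin> topspace X \<Longrightarrow> \<gamma> x = 0"
    and "\<And>f q. f \<in> W \<Longrightarrow> q \<in> continuous_seminorms scl T \<Longrightarrow>
      \<exists>c. \<forall>x\<in>topspace X. f x * q (\<gamma> x) \<le> c"
  shows "\<gamma> \<in> weighted_space X W scl T"
proof -
  have "weighted_norm X f q \<gamma> < \<infinity>" if "f \<in> W" "q \<in> continuous_seminorms scl T" for f q
    using assms(3)[OF that] weighted_norm_finite[of X f q \<gamma>] by blast
  then show ?thesis using assms(1,2) unfolding weighted_space_def by blast
qed

lemma weighted_space_continuous: "\<gamma> \<in> weighted_space X W scl T \<Longrightarrow> continuous_map X T \<gamma>"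
  unfolding weighted_space_def by blast

lemma weighted_space_outside: "\<gamma> \<in> weighted_space X W scl T \<Longrightarrow> x \<notin> topspace X \<Longrightarrow> \<gamma> x = 0"
  unfolding weighted_space_def by blast

lemma weighted_space_value:
  assumes "\<gamma> \<in> weighted_space X W scl T" "x \<in> topspace X"
  shows "\<gamma> x \<in> S"
  using continuous_map_image_subset_topspace[OF weighted_space_continuous[OF assms(1)]] assms(2)
  unfolding topspace_eq by blast

lemma weighted_space_finite:
  "\<gamma> \<in> weighted_space X W scl T \<Longrightarrow> f \<in> W \<Longrightarrow> q \<in> continuous_seminorms scl T \<Longrightarrow>
    weighted_norm X f q \<gamma> < \<infinity>"
  unfolding weighted_space_def by blast

lemma weighted_space_le:
  "\<gamma> \<in> weighted_space X W scl T \<Longrightarrow> f \<in> W \<Longrightarrow> q \<in> continuous_seminorms scl T \<Longrightarrow>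
    x \<in> topspace X \<Longrightarrow> f x * q (\<gamma> x) \<le> weighted_seminorm X f q \<gamma>"
  by (intro le_weighted_seminorm weighted_space_finite)

lemma add_le_weighted:
  assumes \<gamma>: "\<gamma> \<in> weighted_space X W scl T" and \<eta>: "\<eta> \<in> weighted_space X W scl T"
    and f: "f \<in> W" and q: "q \<in> continuous_seminorms scl T" and x: "x \<in> topspace X"
  shows "f x * q (\<gamma> x + \<eta> x) \<le> weighted_seminorm X f q \<gamma> + weighted_seminorm X f q \<eta>"
proof -
  interpret seminorm_on scl S q by (rule seminorm_continuous[OF q])
  have "f x * q (\<gamma> x + \<eta> x) \<le> f x * (q (\<gamma> x) + q (\<eta> x))"
    by (intro mult_left_mono triangle weight_nonneg[OF f x] weighted_space_value[OF _ x] \<gamma> \<eta>)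
  then show ?thesis
    using weighted_space_le[OF \<gamma> f q x] weighted_space_le[OF \<eta> f q x]
    by (simp add: distrib_left)
qed

lemma subspace_weighted_space:
  "module.subspace (pointwise_scale scl) (weighted_space X W scl T)"
proof -
  interpret V: vector_space "pointwise_scale scl :: 'k \<Rightarrow> ('x \<Rightarrow> 'e) \<Rightarrow> 'x \<Rightarrow> 'e"
    by (rule vector_space_pointwise_scale[OF vector_space_axioms])
  show ?thesis
  proof (rule V.subspaceI)
    show "0 \<in> weighted_space X W scl T"
    proof (rule weighted_spaceI)
      show "continuous_map X T 0" using continuous_map_zero[of X] by (simp add: zero_fun_def)
      fix f q assume "q \<in> continuous_seminorms scl T"
      then interpret seminorm_on scl S q by (rule seminorm_continuous)
      show "\<exists>c. \<forall>x\<in>topspace X. f x * q (0 x) \<le> c" using zero by auto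
    qed simp
  next
    fix \<gamma> \<eta> assume \<gamma>: "\<gamma> \<in> weighted_space X W scl T" and \<eta>: "\<eta> \<in> weighted_space X W scl T"
    show "\<gamma> + \<eta> \<in> weighted_space X W scl T"
    proof (rule weighted_spaceI)
      show "continuous_map X T (\<gamma> + \<eta>)"
        using continuous_map_add[OF \<gamma>[THEN weighted_space_continuous] \<eta>[THEN weighted_space_continuous]]
        by (simp add: plus_fun_def)
      show "(\<gamma> + \<eta>) x = 0" if "x \<notin> topspace X" for x
        using that \<gamma> \<eta> by (simp add: weighted_space_outside)
      fix f q assume "f \<in> W" "q \<in> continuous_seminorms scl T"
      then show "\<exists>c. \<forall>x\<in>topspace X. f x * q ((\<gamma> + \<eta>) x) \<le> c"
        using add_le_weighted[OF \<gamma> \<eta>] unfolding plus_fun_apply by blast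
    qed
  next
    fix c \<gamma> assume \<gamma>: "\<gamma> \<in> weighted_space X W scl T"
    show "pointwise_scale scl c \<gamma> \<in> weighted_space X W scl T"
    proof (rule weighted_spaceI)
      show "continuous_map X T (pointwise_scale scl c \<gamma>)"
        unfolding pointwise_scale_def by (rule continuous_map_scale[OF \<gamma>[THEN weighted_space_continuous]])
      show "pointwise_scale scl c \<gamma> x = 0" if "x \<notin> topspace X" for x
        using that \<gamma> by (simp add: pointwise_scale_def weighted_space_outside)
      fix f q assume f: "f \<in> W" and q: "q \<in> continuous_seminorms scl T"
      interpret seminorm_on scl S q by (rule seminorm_continuous[OF q])
      have "f x * q (pointwise_scale scl c \<gamma> x) \<le> norm c * weighted_seminorm X f q \<gamma>"
        if x: "x \<in> topspace X" for x
        using mult_left_mono[OF weighted_space_le[OF \<gamma> f q x] norm_ge_zero[of c]]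
          hom[OF weighted_space_value[OF \<gamma> x]]
        by (simp add: pointwise_scale_def mult.left_commute)
      then show "\<exists>b. \<forall>x\<in>topspace X. f x * q (pointwise_scale scl c \<gamma> x) \<le> b" by blast
    qed
  qed
qed

lemma seminorm_on_weighted:
  assumes f: "f \<in> W" and q: "q \<in> continuous_seminorms scl T"
  shows "seminorm_on (pointwise_scale scl) (weighted_space X W scl T) (weighted_seminorm X f q)"
proof -
  interpret Q: seminorm_on scl S q by (rule seminorm_continuous[OF q])
  interpret V: vector_space "pointwise_scale scl :: 'k \<Rightarrow> ('x \<Rightarrow> 'e) \<Rightarrow> 'x \<Rightarrow> 'e"
    by (rule vector_space_pointwise_scale[OF vector_space_axioms])
  have le: "weighted_seminorm X f q (pointwise_scale scl c \<gamma>) \<le> norm c * weighted_seminorm X f q \<gamma>"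
    if \<gamma>: "\<gamma> \<in> weighted_space X W scl T" for c \<gamma>
  proof (rule weighted_seminorm_le)
    show "0 \<le> norm c * weighted_seminorm X f q \<gamma>" by (simp add: weighted_seminorm_nonneg)
    show "f x * q (pointwise_scale scl c \<gamma> x) \<le> norm c * weighted_seminorm X f q \<gamma>"
      if x: "x \<in> topspace X" for x
      using mult_left_mono[OF weighted_space_le[OF \<gamma> f q x] norm_ge_zero[of c]]
        Q.hom[OF weighted_space_value[OF \<gamma> x]]
      by (simp add: pointwise_scale_def mult.left_commute)
  qed
  show ?thesis
  proof (intro seminorm_on.intro seminorm_on_axioms.intro)
    show "vector_space (pointwise_scale scl :: 'k \<Rightarrow> ('x \<Rightarrow> 'e) \<Rightarrow> 'x \<Rightarrow> 'e)"
      by (rule V.vector_space_axioms)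
    show "V.subspace (weighted_space X W scl T)" by (rule subspace_weighted_space)
    show "0 \<le> weighted_seminorm X f q \<gamma>" for \<gamma> by (rule weighted_seminorm_nonneg)
    show "weighted_seminorm X f q (\<gamma> + \<eta>) \<le> weighted_seminorm X f q \<gamma> + weighted_seminorm X f q \<eta>"
      if "\<gamma> \<in> weighted_space X W scl T" "\<eta> \<in> weighted_space X W scl T" for \<gamma> \<eta>
    proof (rule weighted_seminorm_le)
      show "0 \<le> weighted_seminorm X f q \<gamma> + weighted_seminorm X f q \<eta>"
        by (simp add: weighted_seminorm_nonneg)
      show "f x * q ((\<gamma> + \<eta>) x) \<le> weighted_seminorm X f q \<gamma> + weighted_seminorm X f q \<eta>"
        if "x \<in> topspace X" for x
        using add_le_weighted[OF \<open>\<gamma> \<in> _\<close> \<open>\<eta> \<in> _\<close> f q that] by simp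
    qed
    fix c \<gamma> assume \<gamma>: "\<gamma> \<in> weighted_space X W scl T"
    show "weighted_seminorm X f q (pointwise_scale scl c \<gamma>) = norm c * weighted_seminorm X f q \<gamma>"
    proof (cases "c = 0")
      case True
      then show ?thesis
        using le[OF \<gamma>, of c] weighted_seminorm_nonneg[of X f q "pointwise_scale scl c \<gamma>"] by simp
    next
      case False
      have "weighted_seminorm X f q (pointwise_scale scl (inverse c) (pointwise_scale scl c \<gamma>))
          \<le> norm (inverse c) * weighted_seminorm X f q (pointwise_scale scl c \<gamma>)"
        by (rule le[OF V.subspace_scale[OF subspace_weighted_space \<gamma>]])
      then have "norm c * weighted_seminorm X f q \<gamma> \<le> weighted_seminorm X f q (pointwise_scale scl c \<gamma>)"
        using False by (simp add: norm_divide field_simps)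
      then show ?thesis using le[OF \<gamma>, of c] by linarith
    qed
  qed
qed

text \<open>
  The target \<open>T\<close> may itself be a weighted space, which makes iterated weighted spaces available.
\<close>

lemma seminormed_space_weighted:
  "seminormed_space (pointwise_scale scl) (weighted_space X W scl T)
    (W \<times> continuous_seminorms scl T) (\<lambda>(f, q). weighted_seminorm X f q) (weighted_topology X W scl T)"
proof (intro seminormed_space.intro seminormed_space_axioms.intro)
  interpret V: vector_space "pointwise_scale scl :: 'k \<Rightarrow> ('x \<Rightarrow> 'e) \<Rightarrow> 'x \<Rightarrow> 'e"
    by (rule vector_space_pointwise_scale[OF vector_space_axioms])
  show "vector_space (pointwise_scale scl :: 'k \<Rightarrow> ('x \<Rightarrow> 'e) \<Rightarrow> 'x \<Rightarrow> 'e)"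
    by (rule V.vector_space_axioms)
  show "V.subspace (weighted_space X W scl T)" by (rule subspace_weighted_space)
  show "W \<times> continuous_seminorms scl T \<noteq> {}"
    using weights_nonempty index_nonempty nrm_continuous_seminorm by blast
  show "seminorm_on (pointwise_scale scl) (weighted_space X W scl T)
      ((\<lambda>(f, q). weighted_seminorm X f q) i)"
    if "i \<in> W \<times> continuous_seminorms scl T" for i
    using that by (auto intro: seminorm_on_weighted)
  have ball: "{\<eta> \<in> weighted_space X W scl T. weighted_norm X f q (\<eta> - \<gamma>) < ennreal e} =
      {\<eta> \<in> weighted_space X W scl T. weighted_seminorm X f q (\<eta> - \<gamma>) < e}"
    if "f \<in> W" "q \<in> continuous_seminorms scl T" "\<gamma> \<in> weighted_space X W scl T" for f q \<gamma> e
    using weighted_norm_less_iff[OF weighted_space_finite[OF V.subspace_diff[OF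
          subspace_weighted_space _ that(3)] that(1,2)]]
    by (intro Collect_cong conj_cong refl) simp
  have "{{\<eta> \<in> weighted_space X W scl T. weighted_norm X f q (\<eta> - \<gamma>) < ennreal e} | f q \<gamma> e.
        f \<in> W \<and> q \<in> continuous_seminorms scl T \<and> \<gamma> \<in> weighted_space X W scl T \<and> 0 < e} =
      {{\<eta> \<in> weighted_space X W scl T. (\<lambda>(f, q). weighted_seminorm X f q) i (\<eta> - \<gamma>) < e} | i \<gamma> e.
        i \<in> W \<times> continuous_seminorms scl T \<and> \<gamma> \<in> weighted_space X W scl T \<and> 0 < e}"
    (is "?A = ?B")
  proof (intro equalityI subsetI)
    fix b assume "b \<in> ?A"
    then obtain f q \<gamma> e where i: "f \<in> W" "q \<in> continuous_seminorms scl T"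
        "\<gamma> \<in> weighted_space X W scl T" "0 < e"
      and b: "b = {\<eta> \<in> weighted_space X W scl T. weighted_norm X f q (\<eta> - \<gamma>) < ennreal e}"
      unfolding mem_Collect_eq by (elim exE conjE) (rule that)
    show "b \<in> ?B"
      unfolding b ball[OF i(1-3)] mem_Collect_eq
      by (intro exI[of _ "(f, q)"] exI[of _ \<gamma>] exI[of _ e]) (simp add: i)
  next
    fix b assume "b \<in> ?B"
    then obtain i \<gamma> e where i: "i \<in> W \<times> continuous_seminorms scl T"
        "\<gamma> \<in> weighted_space X W scl T" "0 < e"
      and b: "b = {\<eta> \<in> weighted_space X W scl T. (\<lambda>(f, q). weighted_seminorm X f q) i (\<eta> - \<gamma>) < e}"
      unfolding mem_Collect_eq by (elim exE conjE) (rule that)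
    obtain f q where fq: "i = (f, q)" by (cases i)
    then have fq': "f \<in> W" "q \<in> continuous_seminorms scl T" using i(1) by auto
    show "b \<in> ?A"
      unfolding b fq prod.case ball[OF fq' i(2), symmetric] mem_Collect_eq
      by (intro exI[of _ f] exI[of _ q] exI[of _ \<gamma>] exI[of _ e] conjI refl fq' i)
  qed
  then show "weighted_topology X W scl T = topology_generated_by ?B"
    unfolding weighted_topology_def by (rule arg_cong)
qed

end

lemma continuous_map_linear_seminormed:
  assumes A: "seminormed_space scl S I nrm T" and B: "seminormed_space scl' S' I' nrm' T'"
    and into: "\<And>x. x \<in> S \<Longrightarrow> L x \<in> S'"
    and diff: "\<And>x y. x \<in> S \<Longrightarrow> y \<in> S \<Longrightarrow> L x - L y = L (x - y)"
    and bound: "\<And>j. j \<in> I' \<Longrightarrow> \<exists>q\<in>continuous_seminorms scl T. \<forall>x\<in>S. nrm' j (L x) \<le> q x"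
  shows "continuous_map T T' L"
proof -
  interpret A: seminormed_space scl S I nrm T by (rule A)
  interpret B: seminormed_space scl' S' I' nrm' T' by (rule B)
  show ?thesis
    unfolding B.continuous_map_into_iff A.topspace_eq
  proof (intro conjI ballI allI impI)
    show "L ` S \<subseteq> S'" using into by blast
    fix j x and e :: real
    assume j: "j \<in> I'" and x: "x \<in> S" and e: "0 < e"
    obtain q where q: "q \<in> continuous_seminorms scl T" and le: "\<forall>x\<in>S. nrm' j (L x) \<le> q x"
      using bound[OF j] by (elim bexE) (rule that)
    obtain U where U: "openin T U" "x \<in> U" "\<forall>y\<in>U. q (y - x) < e"
      using A.continuous_map_near[OF continuous_map_id[unfolded id_def] q _ e, of x] x
      unfolding A.topspace_eq by blast
    have "nrm' j (L y - L x) < e" if y: "y \<in> U" for y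
    proof -
      have yS: "y \<in> S" using y openin_subset[OF U(1)] A.topspace_eq by blast
      have "nrm' j (L y - L x) \<le> q (y - x)"
        using le diff[OF yS x] A.subspace_diff[OF A.subspace_carrier yS x] by simp
      then show ?thesis using U(3) y by fastforce
    qed
    then show "\<exists>U. openin T U \<and> x \<in> U \<and> (\<forall>y\<in>U. nrm' j (L y - L x) < e)"
      using U(1,2) by blast
  qed
qed

section \<open>The exponential law\<close>

text \<open>
  The range space is any space topologised by seminorms; a locally convex space is one with all of its
  continuous seminorms as index set.
\<close>

locale weighted_exponential = seminormed_space scl S I nrm T
  for scl :: "'k::real_normed_field \<Rightarrow> 'e::ab_group_add \<Rightarrow> 'e" and S and I :: "'i set" and nrm T +
  fixes X1 :: "'x topology" and W1 :: "('x \<Rightarrow> real) set"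
    and X2 :: "'y topology" and W2 :: "('y \<Rightarrow> real) set"
  assumes weights1: "set_of_weights X1 W1" and weights2: "set_of_weights X2 W2"
    and locally_compact1: "locally_compact_space X1" and locally_compact2: "locally_compact_space X2"
    and o_condition2: "o_condition X2 W2"
    and bounded2: "g \<in> W2 \<Longrightarrow> compactin X2 L \<Longrightarrow> bounded (g ` L)"
    and bounded_below1: "compactin X1 K \<Longrightarrow> \<exists>f\<in>W1. \<exists>c>0. \<forall>x\<in>K. c \<le> f x"
    and bounded_below2: "compactin X2 L \<Longrightarrow> \<exists>g\<in>W2. \<exists>c>0. \<forall>y\<in>L. c \<le> g y"

abbreviation tensor :: "('x \<Rightarrow> real) \<Rightarrow> ('y \<Rightarrow> real) \<Rightarrow> 'x \<times> 'y \<Rightarrow> real" where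
  "tensor f g \<equiv> \<lambda>(x, y). f x * g y"

sublocale weighted_exponential \<subseteq> W2: weighted_functions scl S I nrm T X2 W2
  using weights2 by unfold_locales (auto simp: set_of_weights_def)

sublocale weighted_exponential \<subseteq> F: seminormed_space "pointwise_scale scl" "weighted_space X2 W2 scl T"
    "W2 \<times> continuous_seminorms scl T" "\<lambda>(g, q). weighted_seminorm X2 g q" "weighted_topology X2 W2 scl T"
  by (rule W2.seminormed_space_weighted)

sublocale weighted_exponential \<subseteq> W1: weighted_functions "pointwise_scale scl" "weighted_space X2 W2 scl T"
    "W2 \<times> continuous_seminorms scl T" "\<lambda>(g, q). weighted_seminorm X2 g q" "weighted_topology X2 W2 scl T"
    X1 W1
  using weights1 by unfold_locales (auto simp: set_of_weights_def)

sublocale weighted_exponential \<subseteq> W: weighted_functions scl S I nrm T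
    "prod_topology X1 X2" "tensor_weights W1 W2"
proof unfold_locales
  show "tensor_weights W1 W2 \<noteq> {}"
    using W1.weights_nonempty W2.weights_nonempty unfolding tensor_weights_def by blast
  show "0 \<le> h z" if "h \<in> tensor_weights W1 W2" "z \<in> topspace (prod_topology X1 X2)" for h z
    using that W1.weight_nonneg W2.weight_nonneg unfolding tensor_weights_def by auto
qed

context weighted_exponential
begin

abbreviation iterated_space where
  "iterated_space \<equiv> weighted_space X1 W1 (pointwise_scale scl) (weighted_topology X2 W2 scl T)"

abbreviation joint_space where
  "joint_space \<equiv> weighted_space (prod_topology X1 X2) (tensor_weights W1 W2) scl T"

lemma tensor_in: "f \<in> W1 \<Longrightarrow> g \<in> W2 \<Longrightarrow> tensor f g \<in> tensor_weights W1 W2"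
  unfolding tensor_weights_def by blast

lemma inner_seminorm:
  "g \<in> W2 \<Longrightarrow> q \<in> continuous_seminorms scl T \<Longrightarrow>
    weighted_seminorm X2 g q \<in> continuous_seminorms (pointwise_scale scl) (weighted_topology X2 W2 scl T)"
  using F.nrm_continuous_seminorm[of "(g, q)"] by simp

lemma outer_seminorm:
  "f \<in> W1 \<Longrightarrow> q \<in> continuous_seminorms (pointwise_scale scl) (weighted_topology X2 W2 scl T) \<Longrightarrow>
    weighted_seminorm X1 f q \<in> continuous_seminorms (pointwise_scale (pointwise_scale scl))
      (weighted_topology X1 W1 (pointwise_scale scl) (weighted_topology X2 W2 scl T))"
  using seminormed_space.nrm_continuous_seminorm[OF W1.seminormed_space_weighted, of "(f, q)"] by simp

lemma joint_seminorm:
  "f \<in> W1 \<Longrightarrow> g \<in> W2 \<Longrightarrow> q \<in> continuous_seminorms scl T \<Longrightarrow>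
    weighted_seminorm (prod_topology X1 X2) (tensor f g) q \<in> continuous_seminorms (pointwise_scale scl)
      (weighted_topology (prod_topology X1 X2) (tensor_weights W1 W2) scl T)"
  using seminormed_space.nrm_continuous_seminorm[OF W.seminormed_space_weighted, of "(tensor f g, q)"]
  by (simp add: tensor_in)

lemma hat_le:
  assumes \<gamma>: "\<gamma> \<in> iterated_space" and f: "f \<in> W1" and g: "g \<in> W2"
    and q: "q \<in> continuous_seminorms scl T" and z: "z \<in> topspace (prod_topology X1 X2)"
  shows "tensor f g z * q (hat \<gamma> z) \<le> weighted_seminorm X1 f (weighted_seminorm X2 g q) \<gamma>"
proof -
  obtain x y where xy: "z = (x, y)" by (cases z)
  have x: "x \<in> topspace X1" and y: "y \<in> topspace X2" using z xy by auto
  have "f x * (g y * q (\<gamma> x y)) \<le> f x * weighted_seminorm X2 g q (\<gamma> x)"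
    by (intro mult_left_mono W2.weighted_space_le[OF W1.weighted_space_value[OF \<gamma> x] g q y]
        W1.weight_nonneg[OF f x])
  also have "\<dots> \<le> weighted_seminorm X1 f (weighted_seminorm X2 g q) \<gamma>"
    by (rule W1.weighted_space_le[OF \<gamma> f inner_seminorm[OF g q] x])
  finally show ?thesis unfolding xy by (simp add: hat_def mult.assoc)
qed

text \<open>
  At \<open>(a, b)\<close>, split \<open>\<gamma> x y - \<gamma> a b\<close> at \<open>\<gamma> a y\<close>. The second part is small by continuity of \<open>\<gamma> a\<close>. For
  the first part, a weight \<open>g \<ge> c > 0\<close> on a compact neighbourhood of \<open>b\<close> turns the seminorm of
  \<open>\<gamma> x - \<gamma> a\<close> for \<open>g\<close> into a bound that is uniform in \<open>y\<close>.
\<close>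

lemma continuous_map_hat:
  assumes \<gamma>: "\<gamma> \<in> iterated_space"
  shows "continuous_map (prod_topology X1 X2) T (hat \<gamma>)"
  unfolding continuous_map_into_iff
proof (intro conjI ballI allI impI)
  have val: "\<gamma> x y \<in> S" if "x \<in> topspace X1" "y \<in> topspace X2" for x y
    by (rule W2.weighted_space_value[OF W1.weighted_space_value[OF \<gamma> that(1)] that(2)])
  then show "hat \<gamma> ` topspace (prod_topology X1 X2) \<subseteq> S" by (auto simp: hat_def)
  fix i z and e :: real
  assume i: "i \<in> I" and z: "z \<in> topspace (prod_topology X1 X2)" and e: "0 < e"
  interpret seminorm_on scl S "nrm i" by (rule seminorm_nrm[OF i])
  note p = nrm_continuous_seminorm[OF i]
  obtain a b where ab: "z = (a, b)" by (cases z)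
  have a: "a \<in> topspace X1" and b: "b \<in> topspace X2" using z ab by auto
  obtain U L where U: "openin X2 U" "b \<in> U" and L: "compactin X2 L" and UL: "U \<subseteq> L"
    using locally_compact2 b unfolding locally_compact_space_def by blast
  obtain g c where g: "g \<in> W2" and c: "0 < c" "\<forall>y\<in>L. c \<le> g y"
    using bounded_below2[OF L] by blast
  have \<gamma>a: "\<gamma> a \<in> weighted_space X2 W2 scl T" by (rule W1.weighted_space_value[OF \<gamma> a])
  have ce: "0 < c * (e / 2)" and e2: "0 < e / 2" using c(1) e by simp_all
  obtain V1 where V1: "openin X1 V1" "a \<in> V1"
      "\<forall>x\<in>V1. weighted_seminorm X2 g (nrm i) (\<gamma> x - \<gamma> a) < c * (e / 2)"
    using F.continuous_map_near[OF W1.weighted_space_continuous[OF \<gamma>] inner_seminorm[OF g p] a ce]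
    by (elim exE conjE) (rule that)
  obtain V2 where V2: "openin X2 V2" "b \<in> V2" "\<forall>y\<in>V2. nrm i (\<gamma> a y - \<gamma> a b) < e / 2"
    using continuous_map_near[OF W2.weighted_space_continuous[OF \<gamma>a] p b e2]
    by (elim exE conjE) (rule that)
  have "nrm i (hat \<gamma> w - hat \<gamma> z) < e" if w: "w \<in> V1 \<times> (V2 \<inter> U)" for w
  proof -
    obtain x y where xy: "w = (x, y)" by (cases w)
    have x: "x \<in> V1" and y: "y \<in> V2" "y \<in> L" using w xy UL by auto
    have xX: "x \<in> topspace X1" and yX: "y \<in> topspace X2"
      using x y(1) openin_subset[OF V1(1)] openin_subset[OF V2(1)] by auto
    have "\<gamma> x - \<gamma> a \<in> weighted_space X2 W2 scl T"
      by (rule F.subspace_diff[OF F.subspace_carrier W1.weighted_space_value[OF \<gamma> xX] \<gamma>a])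
    from W2.weighted_space_le[OF this g p yX]
    have "g y * nrm i (\<gamma> x y - \<gamma> a y) \<le> weighted_seminorm X2 g (nrm i) (\<gamma> x - \<gamma> a)" by simp
    moreover have "c * nrm i (\<gamma> x y - \<gamma> a y) \<le> g y * nrm i (\<gamma> x y - \<gamma> a y)"
      using c(2) y(2) by (intro mult_right_mono nonneg subspace_diff[OF subspace_carrier] val xX yX a) auto
    moreover have "weighted_seminorm X2 g (nrm i) (\<gamma> x - \<gamma> a) < c * (e / 2)" using V1(3) x by blast
    ultimately have "c * nrm i (\<gamma> x y - \<gamma> a y) < c * (e / 2)" by linarith
    then have "nrm i (\<gamma> x y - \<gamma> a y) < e / 2" using c(1) by simp
    moreover have "nrm i (\<gamma> a y - \<gamma> a b) < e / 2" using V2(3) y(1) by blast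
    ultimately show ?thesis
      using triangle_diff[OF val[OF xX yX] val[OF a yX] val[OF a b]]
      unfolding xy ab hat_def prod.case by linarith
  qed
  moreover have "openin (prod_topology X1 X2) (V1 \<times> (V2 \<inter> U))"
    using V1(1) V2(1) U(1) by (simp add: openin_prod_Times_iff openin_Int)
  moreover have "z \<in> V1 \<times> (V2 \<inter> U)" using V1(2) V2(2) U(2) ab by simp
  ultimately show "\<exists>U. openin (prod_topology X1 X2) U \<and> z \<in> U \<and>
      (\<forall>w\<in>U. nrm i (hat \<gamma> w - hat \<gamma> z) < e)" by blast
qed

lemma hat_in:
  assumes \<gamma>: "\<gamma> \<in> iterated_space"
  shows "hat \<gamma> \<in> joint_space"
proof (rule W.weighted_spaceI)
  show "continuous_map (prod_topology X1 X2) T (hat \<gamma>)" by (rule continuous_map_hat[OF \<gamma>])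
  show "hat \<gamma> z = 0" if z: "z \<notin> topspace (prod_topology X1 X2)" for z
  proof (cases "fst z \<in> topspace X1")
    case True
    then have "snd z \<notin> topspace X2" using z by (auto simp: mem_Times_iff)
    then show ?thesis
      using W2.weighted_space_outside[OF W1.weighted_space_value[OF \<gamma> True]]
      by (simp add: hat_def case_prod_unfold)
  next
    case False
    then show ?thesis
      using W1.weighted_space_outside[OF \<gamma> False] by (simp add: hat_def case_prod_unfold)
  qed
  fix h q assume "h \<in> tensor_weights W1 W2" and q: "q \<in> continuous_seminorms scl T"
  then obtain f g where "f \<in> W1" "g \<in> W2" "h = tensor f g" unfolding tensor_weights_def by blast
  then show "\<exists>c. \<forall>z\<in>topspace (prod_topology X1 X2). h z * q (hat \<gamma> z) \<le> c"
    using hat_le[OF \<gamma> _ _ q] by blast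
qed

text \<open>
  The joint seminorm bounds each section \<open>\<eta> (x, _)\<close>, with a factor \<open>f x\<close>. If \<open>f x = 0\<close> the
  second inequality is trivial, whatever the section is.
\<close>

lemma section_le:
  assumes \<eta>: "\<eta> \<in> joint_space" and f: "f \<in> W1" and g: "g \<in> W2"
    and q: "q \<in> continuous_seminorms scl T" and x: "x \<in> topspace X1"
  shows "y \<in> topspace X2 \<Longrightarrow> f x * (g y * q (\<eta> (x, y)))
      \<le> weighted_seminorm (prod_topology X1 X2) (tensor f g) q \<eta>"
    and "f x * weighted_seminorm X2 g q (\<lambda>y. \<eta> (x, y))
      \<le> weighted_seminorm (prod_topology X1 X2) (tensor f g) q \<eta>" (is "_ \<le> ?N")
proof -
  show le: "f x * (g y * q (\<eta> (x, y))) \<le> ?N" if "y \<in> topspace X2" for y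
    using W.weighted_space_le[OF \<eta> tensor_in[OF f g] q, of "(x, y)"] x that
    by (simp add: mult.assoc)
  show "f x * weighted_seminorm X2 g q (\<lambda>y. \<eta> (x, y)) \<le> ?N"
  proof (cases "f x = 0")
    case True
    then show ?thesis by (simp add: weighted_seminorm_nonneg)
  next
    case False
    then have fx: "0 < f x" using W1.weight_nonneg[OF f x] by linarith
    have "weighted_seminorm X2 g q (\<lambda>y. \<eta> (x, y)) \<le> ?N / f x"
      using le fx by (intro weighted_seminorm_le) (simp_all add: weighted_seminorm_nonneg field_simps)
    then show ?thesis using fx by (simp add: field_simps)
  qed
qed

text \<open>
  Some weight \<open>f\<close> is positive at \<open>x\<close>, and dividing the bound \<open>section_le\<close> by \<open>f x\<close> makes the
  section weighted.
\<close>

lemma section_in: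
  assumes \<eta>: "\<eta> \<in> joint_space"
  shows "(\<lambda>y. \<eta> (x, y)) \<in> weighted_space X2 W2 scl T"
proof (cases "x \<in> topspace X1")
  case True
  show ?thesis
  proof (rule W2.weighted_spaceI)
    have "continuous_map X2 (prod_topology X1 X2) (\<lambda>y. (x, y))"
      using True by (intro continuous_map_pairedI continuous_map_id[unfolded id_def]) simp
    from continuous_map_compose[OF this W.weighted_space_continuous[OF \<eta>]]
    show "continuous_map X2 T (\<lambda>y. \<eta> (x, y))" by (simp add: o_def)
    show "\<eta> (x, y) = 0" if "y \<notin> topspace X2" for y
      using W.weighted_space_outside[OF \<eta>, of "(x, y)"] that by simp
    fix g q assume g: "g \<in> W2" and q: "q \<in> continuous_seminorms scl T"
    obtain f where f: "f \<in> W1" "0 < f x" using weights1 True unfolding set_of_weights_def by blast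
    have "g y * q (\<eta> (x, y)) \<le> weighted_seminorm (prod_topology X1 X2) (tensor f g) q \<eta> / f x"
      if "y \<in> topspace X2" for y
      using section_le(1)[OF \<eta> f(1) g q True that] f(2) by (simp add: field_simps)
    then show "\<exists>c. \<forall>y\<in>topspace X2. g y * q (\<eta> (x, y)) \<le> c" by blast
  qed
next
  case False
  then have "(\<lambda>y. \<eta> (x, y)) = 0"
    using W.weighted_space_outside[OF \<eta>] by (auto simp: fun_eq_iff)
  then show ?thesis using F.subspace_0[OF F.subspace_carrier] by simp
qed

text \<open>
  This is where the \<open>o\<close>-condition acts. With \<open>g = o(g')\<close>, the values of a section with weight \<open>g\<close> are
  uniformly small outside a compact set \<open>L\<close>, since those with weight \<open>g'\<close> are bounded by \<open>M / c\<close>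
  for all \<open>x\<close> in a neighbourhood of \<open>a\<close>. On \<open>L\<close> the weight \<open>g\<close> is bounded and the tube lemma applies.
\<close>

lemma continuous_map_section:
  assumes \<eta>: "\<eta> \<in> joint_space"
  shows "continuous_map X1 (weighted_topology X2 W2 scl T) (\<lambda>x y. \<eta> (x, y))"
  unfolding F.continuous_map_into_iff
proof (intro conjI ballI allI impI)
  show "(\<lambda>x y. \<eta> (x, y)) ` topspace X1 \<subseteq> weighted_space X2 W2 scl T"
    by (intro image_subsetI section_in[OF \<eta>])
  fix i a and e :: real
  assume i: "i \<in> W2 \<times> continuous_seminorms scl T" and a: "a \<in> topspace X1" and e: "0 < e"
  obtain g q where gq: "i = (g, q)" by (cases i)
  have g: "g \<in> W2" and q: "q \<in> continuous_seminorms scl T" using i gq by auto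
  interpret seminorm_on scl S q by (rule seminorm_continuous[OF q])
  have val: "\<eta> (x, y) \<in> S" if "x \<in> topspace X1" "y \<in> topspace X2" for x y
    using W.weighted_space_value[OF \<eta>, of "(x, y)"] that by simp
  obtain U0 K where U0: "openin X1 U0" "a \<in> U0" and K: "compactin X1 K" and UK: "U0 \<subseteq> K"
    using locally_compact1 a unfolding locally_compact_space_def by blast
  obtain f c where f: "f \<in> W1" and c: "0 < c" "\<forall>x\<in>K. c \<le> f x"
    using bounded_below1[OF K] by blast
  obtain g' where g': "g' \<in> W2" and o: "little_o_on X2 g g'"
    using o_condition2 g unfolding o_condition_def by blast
  define M where "M = weighted_seminorm (prod_topology X1 X2) (tensor f g') q \<eta>"
  have M: "0 \<le> M" unfolding M_def by (rule weighted_seminorm_nonneg)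
  \<comment> \<open>Outside \<open>L\<close> the difference of two sections contributes at most \<open>d * (M / c + M / c) \<le> e / 2\<close>.\<close>
  define d where "d = c * e / (4 * (M + 1))"
  have d: "0 < d" using c(1) e M unfolding d_def by simp
  obtain L where L: "compactin X2 L" and off: "\<forall>y\<in>topspace X2 - L. g y \<le> d * g' y"
    using o d unfolding little_o_on_def by blast
  obtain B where B: "0 < B" "\<forall>y\<in>L. \<bar>g y\<bar> \<le> B"
    using bounded2[OF g L] unfolding bounded_pos by auto
  have tail: "g' y * q (\<eta> (x, y)) \<le> M / c" if x: "x \<in> U0" and y: "y \<in> topspace X2" for x y
  proof -
    have xX: "x \<in> topspace X1" using x openin_subset[OF U0(1)] by blast
    have "0 \<le> g' y * q (\<eta> (x, y))"
      using W2.weight_nonneg[OF g' y] nonneg[OF val[OF xX y]] by simp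
    then have "c * (g' y * q (\<eta> (x, y))) \<le> f x * (g' y * q (\<eta> (x, y)))"
      using c(2) x UK by (intro mult_right_mono) auto
    also have "\<dots> \<le> M" unfolding M_def by (rule section_le(1)[OF \<eta> f g' q xX y])
    finally show ?thesis using c(1) by (simp add: field_simps)
  qed
  let ?D = "\<lambda>z. \<eta> z - \<eta> (a, snd z)"
  let ?P = "prod_topology X1 X2"
  have "continuous_map ?P ?P (\<lambda>z. (a, snd z))"
    using a by (intro continuous_map_pairedI continuous_map_snd) simp
  from continuous_map_compose[OF this W.weighted_space_continuous[OF \<eta>]]
  have D: "continuous_map ?P T ?D"
    by (intro continuous_map_diff W.weighted_space_continuous[OF \<eta>]) (simp add: o_def)
  have qc: "continuous_map T euclideanreal q" using q unfolding continuous_seminorms_def by blast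
  \<comment> \<open>This open set contains \<open>{a} \<times> L\<close>, since \<open>\<eta> z - \<eta> (a, snd z)\<close> vanishes there.\<close>
  let ?O = "{z \<in> topspace ?P. (q \<circ> ?D) z \<in> {..<e / (2 * B)}}"
  have "openin ?P ?O"
    by (rule openin_continuous_map_preimage[OF continuous_map_compose[OF D qc]]) simp
  moreover have "{a} \<times> L \<subseteq> ?O"
    using a compactin_subset_topspace[OF L] zero e B(1) by auto
  ultimately have "\<exists>U V. openin X1 U \<and> openin X2 V \<and> a \<in> U \<and> L \<subseteq> V \<and> U \<times> V \<subseteq> ?O"
    by (intro tube_lemma_right[OF _ L a])
  then obtain U V where U: "openin X1 U" "a \<in> U" and LV: "L \<subseteq> V" and UV: "U \<times> V \<subseteq> ?O"
    by (elim exE conjE) (rule that)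
  have "weighted_seminorm X2 g q ((\<lambda>y. \<eta> (x, y)) - (\<lambda>y. \<eta> (a, y))) < e" if x: "x \<in> U \<inter> U0" for x
  proof -
    have xX: "x \<in> topspace X1" using x openin_subset[OF U(1)] by blast
    have "g y * q (\<eta> (x, y) - \<eta> (a, y)) \<le> e / 2" if y: "y \<in> topspace X2" for y
    proof (cases "y \<in> L")
      case True
      have "(x, y) \<in> ?O" using UV LV x True by blast
      then have "q (\<eta> (x, y) - \<eta> (a, y)) < e / (2 * B)" by simp
      moreover have "g y \<le> B" using B(2) True by fastforce
      moreover have "0 \<le> q (\<eta> (x, y) - \<eta> (a, y))"
        by (intro nonneg subspace_diff[OF subspace_carrier] val xX a y)
      ultimately have "g y * q (\<eta> (x, y) - \<eta> (a, y)) \<le> B * (e / (2 * B))"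
        using B(1) by (intro mult_mono) auto
      then show ?thesis using B(1) by simp
    next
      case False
      have "g y * q (\<eta> (x, y) - \<eta> (a, y)) \<le> (d * g' y) * (q (\<eta> (x, y)) + q (\<eta> (a, y)))"
        using off y False W2.weight_nonneg[OF g' y] d
        by (intro mult_mono diff_le_add val xX a nonneg subspace_diff[OF subspace_carrier]) auto
      also have "\<dots> = d * (g' y * q (\<eta> (x, y)) + g' y * q (\<eta> (a, y)))" by (simp add: algebra_simps)
      also have "\<dots> \<le> d * (M / c + M / c)"
        using d x y U0(2) by (intro mult_left_mono add_mono tail) auto
      also have "\<dots> = e / 2 * (M / (M + 1))" using c(1) M unfolding d_def by (simp add: field_simps)
      also have "\<dots> \<le> e / 2 * 1" using M e by (intro mult_left_mono) (auto simp: field_simps)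
      finally show ?thesis by simp
    qed
    then have "weighted_seminorm X2 g q ((\<lambda>y. \<eta> (x, y)) - (\<lambda>y. \<eta> (a, y))) \<le> e / 2"
      using e by (intro weighted_seminorm_le) auto
    then show ?thesis using e by linarith
  qed
  then show "\<exists>U. openin X1 U \<and> a \<in> U \<and> (\<forall>x\<in>U. (case i of (g, q) \<Rightarrow> weighted_seminorm X2 g q)
      ((\<lambda>y. \<eta> (x, y)) - (\<lambda>y. \<eta> (a, y))) < e)"
    unfolding gq prod.case using U U0 by (intro exI[of _ "U \<inter> U0"]) (simp add: openin_Int)
qed

text \<open>
  A continuous seminorm \<open>Q\<close> on the inner space is dominated by finitely many seminorms \<open>(g, q)\<close>, and
  each of these contributes the joint seminorm for \<open>(f \<otimes> g, q)\<close>. The bound \<open>p\<close> does not depend on \<open>\<eta>\<close>,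
  so it gives both membership in the iterated space and continuity of the inverse operator.
\<close>

lemma section_bound:
  assumes f: "f \<in> W1"
    and Q: "Q \<in> continuous_seminorms (pointwise_scale scl) (weighted_topology X2 W2 scl T)"
  shows "\<exists>p\<in>continuous_seminorms (pointwise_scale scl)
        (weighted_topology (prod_topology X1 X2) (tensor_weights W1 W2) scl T).
      \<forall>\<eta>\<in>joint_space. \<forall>x\<in>topspace X1. f x * Q (\<lambda>y. \<eta> (x, y)) \<le> p \<eta>"
proof -
  obtain J C where J: "finite J" "J \<subseteq> W2 \<times> continuous_seminorms scl T" and C: "0 \<le> C"
    and le: "\<And>\<zeta>. \<zeta> \<in> weighted_space X2 W2 scl T \<Longrightarrow>
        Q \<zeta> \<le> C * (\<Sum>j\<in>J. (\<lambda>(g, q). weighted_seminorm X2 g q) j \<zeta>)"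
    by (rule F.continuous_seminorm_bound[OF Q]) (rule that)
  define n :: "('y \<Rightarrow> real) \<times> ('e \<Rightarrow> real) \<Rightarrow> ('x \<times> 'y \<Rightarrow> 'e) \<Rightarrow> real"
    where "n = (\<lambda>(g, q). weighted_seminorm (prod_topology X1 X2) (tensor f g) q)"
  have "n j \<in> continuous_seminorms (pointwise_scale scl)
      (weighted_topology (prod_topology X1 X2) (tensor_weights W1 W2) scl T)" if "j \<in> J" for j
    using subsetD[OF J(2) that] joint_seminorm[OF f] unfolding n_def by auto
  then have "(\<lambda>\<eta>. C * (\<Sum>j\<in>J. n j \<eta>)) \<in> continuous_seminorms (pointwise_scale scl)
      (weighted_topology (prod_topology X1 X2) (tensor_weights W1 W2) scl T)"
    by (rule seminormed_space.continuous_seminorm_scaled_sum[OF W.seminormed_space_weighted J(1) C])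
  moreover have "f x * Q (\<lambda>y. \<eta> (x, y)) \<le> C * (\<Sum>j\<in>J. n j \<eta>)"
    if \<eta>: "\<eta> \<in> joint_space" and x: "x \<in> topspace X1" for \<eta> x
  proof -
    let ?\<zeta> = "\<lambda>y. \<eta> (x, y)"
    have summand: "f x * (\<lambda>(g, q). weighted_seminorm X2 g q) j ?\<zeta> \<le> n j \<eta>" if "j \<in> J" for j
      using subsetD[OF J(2) that] section_le(2)[OF \<eta> f _ _ x] unfolding n_def by auto
    have "f x * Q ?\<zeta> \<le> f x * (C * (\<Sum>j\<in>J. (\<lambda>(g, q). weighted_seminorm X2 g q) j ?\<zeta>))"
      by (intro mult_left_mono le section_in[OF \<eta>] W1.weight_nonneg[OF f x])
    also have "\<dots> = C * (\<Sum>j\<in>J. f x * (\<lambda>(g, q). weighted_seminorm X2 g q) j ?\<zeta>)"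
      by (simp add: sum_distrib_left mult.left_commute)
    also have "\<dots> \<le> C * (\<Sum>j\<in>J. n j \<eta>)"
      by (intro mult_left_mono sum_mono summand C)
    finally show ?thesis .
  qed
  ultimately show ?thesis by (intro bexI[of _ "\<lambda>\<eta>. C * (\<Sum>j\<in>J. n j \<eta>)"] ballI)
qed

lemma section_map_in:
  assumes \<eta>: "\<eta> \<in> joint_space"
  shows "(\<lambda>x y. \<eta> (x, y)) \<in> iterated_space"
proof (rule W1.weighted_spaceI)
  show "continuous_map X1 (weighted_topology X2 W2 scl T) (\<lambda>x y. \<eta> (x, y))"
    by (rule continuous_map_section[OF \<eta>])
  show "(\<lambda>y. \<eta> (x, y)) = 0" if "x \<notin> topspace X1" for x
    using W.weighted_space_outside[OF \<eta>] that by (auto simp: fun_eq_iff)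
  fix f Q
  assume "f \<in> W1" "Q \<in> continuous_seminorms (pointwise_scale scl) (weighted_topology X2 W2 scl T)"
  from section_bound[OF this] \<eta>
  show "\<exists>c. \<forall>x\<in>topspace X1. f x * Q (\<lambda>y. \<eta> (x, y)) \<le> c" by blast
qed

lemma continuous_map_hat_operator:
  "continuous_map
    (weighted_topology X1 W1 (pointwise_scale scl) (weighted_topology X2 W2 scl T))
    (weighted_topology (prod_topology X1 X2) (tensor_weights W1 W2) scl T) hat"
proof (rule continuous_map_linear_seminormed[OF W1.seminormed_space_weighted W.seminormed_space_weighted])
  show "hat \<gamma> \<in> joint_space" if "\<gamma> \<in> iterated_space" for \<gamma> using that by (rule hat_in)
  show "hat \<gamma> - hat \<eta> = hat (\<gamma> - \<eta>)" for \<gamma> \<eta> :: "'x \<Rightarrow> 'y \<Rightarrow> 'e"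
    by (simp add: hat_def fun_eq_iff)
  fix j assume "j \<in> tensor_weights W1 W2 \<times> continuous_seminorms scl T"
  then obtain f g q where f: "f \<in> W1" and g: "g \<in> W2" and q: "q \<in> continuous_seminorms scl T"
    and j: "j = (tensor f g, q)" unfolding tensor_weights_def by blast
  have "weighted_seminorm (prod_topology X1 X2) (tensor f g) q (hat \<gamma>)
      \<le> weighted_seminorm X1 f (weighted_seminorm X2 g q) \<gamma>" if "\<gamma> \<in> iterated_space" for \<gamma>
    by (intro weighted_seminorm_le weighted_seminorm_nonneg hat_le[OF that f g q])
  then show "\<exists>p\<in>continuous_seminorms (pointwise_scale (pointwise_scale scl))
        (weighted_topology X1 W1 (pointwise_scale scl) (weighted_topology X2 W2 scl T)).
      \<forall>\<gamma>\<in>iterated_space. (case j of (f, q) \<Rightarrow> weighted_seminorm (prod_topology X1 X2) f q) (hat \<gamma>) \<le> p \<gamma>"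
    unfolding j prod.case
    by (intro bexI[OF _ outer_seminorm[OF f inner_seminorm[OF g q]]] ballI)
qed

lemma continuous_map_section_operator:
  "continuous_map
    (weighted_topology (prod_topology X1 X2) (tensor_weights W1 W2) scl T)
    (weighted_topology X1 W1 (pointwise_scale scl) (weighted_topology X2 W2 scl T))
    (\<lambda>\<eta> x y. \<eta> (x, y))"
proof (rule continuous_map_linear_seminormed[OF W.seminormed_space_weighted W1.seminormed_space_weighted])
  show "(\<lambda>x y. \<eta> (x, y)) \<in> iterated_space" if "\<eta> \<in> joint_space" for \<eta>
    using that by (rule section_map_in)
  show "(\<lambda>x y. \<gamma> (x, y)) - (\<lambda>x y. \<eta> (x, y)) = (\<lambda>x y. (\<gamma> - \<eta>) (x, y))" for \<gamma> \<eta> :: "'x \<times> 'y \<Rightarrow> 'e"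
    by (simp add: fun_eq_iff)
  fix j assume j: "j \<in> W1 \<times> continuous_seminorms (pointwise_scale scl) (weighted_topology X2 W2 scl T)"
  obtain f Q where fQ: "j = (f, Q)" by (cases j)
  have f: "f \<in> W1"
    and Q: "Q \<in> continuous_seminorms (pointwise_scale scl) (weighted_topology X2 W2 scl T)"
    using j fQ by auto
  obtain p where p: "p \<in> continuous_seminorms (pointwise_scale scl)
        (weighted_topology (prod_topology X1 X2) (tensor_weights W1 W2) scl T)"
    and le: "\<forall>\<eta>\<in>joint_space. \<forall>x\<in>topspace X1. f x * Q (\<lambda>y. \<eta> (x, y)) \<le> p \<eta>"
    using section_bound[OF f Q] by (elim bexE) (rule that)
  interpret p: seminorm_on "pointwise_scale scl" joint_space p
    by (rule seminormed_space.seminorm_continuous[OF W.seminormed_space_weighted p])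
  have "weighted_seminorm X1 f Q (\<lambda>x y. \<eta> (x, y)) \<le> p \<eta>" if "\<eta> \<in> joint_space" for \<eta>
    using le that by (intro weighted_seminorm_le p.nonneg[OF that]) blast
  then show "\<exists>p\<in>continuous_seminorms (pointwise_scale scl)
        (weighted_topology (prod_topology X1 X2) (tensor_weights W1 W2) scl T).
      \<forall>\<eta>\<in>joint_space. (case j of (f, q) \<Rightarrow> weighted_seminorm X1 f q) (\<lambda>x y. \<eta> (x, y)) \<le> p \<eta>"
    unfolding fQ prod.case by (intro bexI[OF _ p] ballI)
qed

lemma linear_between_hat:
  "linear_between (pointwise_scale (pointwise_scale scl)) iterated_space
    (pointwise_scale scl) joint_space hat"
  unfolding linear_between_def
proof (intro conjI ballI allI)
  show "module.subspace (pointwise_scale (pointwise_scale scl)) iterated_space"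
    by (rule W1.subspace_weighted_space)
  show "module.subspace (pointwise_scale scl) joint_space"
    by (rule W.subspace_weighted_space)
  show "hat ` iterated_space \<subseteq> joint_space" by (intro image_subsetI hat_in)
qed (simp_all add: hat_def pointwise_scale_def fun_eq_iff)

lemma homeomorphic_map_hat:
  "homeomorphic_map
    (weighted_topology X1 W1 (pointwise_scale scl) (weighted_topology X2 W2 scl T))
    (weighted_topology (prod_topology X1 X2) (tensor_weights W1 W2) scl T) hat"
proof -
  have "homeomorphic_maps
      (weighted_topology X1 W1 (pointwise_scale scl) (weighted_topology X2 W2 scl T))
      (weighted_topology (prod_topology X1 X2) (tensor_weights W1 W2) scl T)
      hat (\<lambda>\<eta> x y. \<eta> (x, y))"
    unfolding homeomorphic_maps_def
    by (intro conjI continuous_map_hat_operator continuous_map_section_operator)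
      (simp_all add: hat_def)
  then show ?thesis by (rule homeomorphic_maps_map[THEN iffD1, THEN conjunct1])
qed

end

lemma weight_bounded_below:
  assumes "0 < (INF x\<in>K. ennreal (f x))"
  shows "\<exists>c>0. \<forall>x\<in>K. c \<le> f x"
proof -
  obtain r where r: "0 < r" "r < (INF x\<in>K. ennreal (f x))" using dense[OF assms] by blast
  then have "r < \<infinity>" using order_less_le_trans[OF r(2), of \<infinity>] by simp
  then have er: "r = ennreal (enn2real r)" by simp
  have "enn2real r \<le> f x" if "x \<in> K" for x
  proof -
    have "ennreal (enn2real r) < ennreal (f x)"
      unfolding er[symmetric] using order_less_le_trans[OF r(2) INF_lower[OF that]] .
    then show ?thesis by (simp add: ennreal_less_iff less_imp_le)
  qed
  moreover have "0 < enn2real r" using r(1) \<open>r < \<infinity>\<close> by (simp add: enn2real_positive_iff)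
  ultimately show ?thesis by blast
qed
theorem theorem2p21:
  fixes X1 :: "'x topology" and X2 :: "'y topology"
    and scl :: "'k::real_normed_field \<Rightarrow> 'e::ab_group_add \<Rightarrow> 'e" and E :: "'e topology"
    and W1 :: "('x \<Rightarrow> real) set" and W2 :: "('y \<Rightarrow> real) set"
  assumes "locally_compact_space X1" and "Hausdorff_space X1"
    and "locally_compact_space X2" and "Hausdorff_space X2"
    and "locally_convex_space scl E" and "Hausdorff_space E"
    and "set_of_weights X1 W1" and "set_of_weights X2 W2"
    and "o_condition X1 W1" and "o_condition X2 W2"
    and "\<forall>f\<in>W1. \<forall>K. compactin X1 K \<longrightarrow> bounded (f ` K)"
    and "\<forall>g\<in>W2. \<forall>L. compactin X2 L \<longrightarrow> bounded (g ` L)"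
    and "\<forall>K. compactin X1 K \<longrightarrow> (\<exists>f\<in>W1. 0 < (INF x\<in>K. ennreal (f x)))"
    and "\<forall>L. compactin X2 L \<longrightarrow> (\<exists>g\<in>W2. 0 < (INF y\<in>L. ennreal (g y)))"
  shows "linear_between
           (pointwise_scale (pointwise_scale scl))
           (weighted_space X1 W1 (pointwise_scale scl) (weighted_topology X2 W2 scl E))
           (pointwise_scale scl)
           (weighted_space (prod_topology X1 X2) (tensor_weights W1 W2) scl E)
           hat
       \<and> homeomorphic_map
           (weighted_topology X1 W1 (pointwise_scale scl) (weighted_topology X2 W2 scl E))
           (weighted_topology (prod_topology X1 X2) (tensor_weights W1 W2) scl E)
           hat"
proof -
  interpret E: locally_convex_space scl E by fact
  interpret weighted_exponential scl "topspace E" "continuous_seminorms scl E" "\<lambda>q. q" E X1 W1 X2 W2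
  proof (intro weighted_exponential.intro weighted_exponential_axioms.intro)
    show "seminormed_space scl (topspace E) (continuous_seminorms scl E) (\<lambda>q. q) E"
      by (rule E.seminormed_space_locally_convex)
    show "\<exists>f\<in>W1. \<exists>c>0. \<forall>x\<in>K. c \<le> f x" if "compactin X1 K" for K
      using assms(13) that weight_bounded_below by blast
    show "\<exists>g\<in>W2. \<exists>c>0. \<forall>y\<in>L. c \<le> g y" if "compactin X2 L" for L
      using assms(14) that weight_bounded_below by blast
  qed (use assms in blast)+
  show ?thesis by (intro conjI linear_between_hat homeomorphic_map_hat)
qed

end
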